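(* Let $G$ be a finite abelian group, and let $r>q\geq 0$ and $m\geq |G|$ be integers with $\exp(G)\mid m$. Then $$(r-q)m+\max(q,D(G)-1)\leq R(S(r,q,m),G)\leq (r-q)m+\min\big((r-q)(D(G)-1),|G|-1\big)+q.$$
   Context: $\exp(G)$ is the exponent of $G$. $D(G)$ (the Davenport constant) is the smallest positive integer $d$ such that every sequence of $d$ elements of $G$ has a nonempty subsequence with sum $0$. A collection of $m$ distinct $r$-sets $e_1,\dots,e_m$ is a delta-system of type $S(r,q,m)$ if there is a set $Q$ with $|Q|=q<r$ such that $e_i\cap e_j=Q$ for all $1\le i<j\le m$. $K_d^{(r)}$ is the complete $r$-uniform hypergraph on $d$ vertices, and a $G$-coloring of it is any map $c$ from its edge set to $G$. $R(S(r,q,m),G)$ is the smallest positive integer $d$ such that for every $G$-coloring $c$ of $K_d^{(r)}$ there is a delta-system $e_1,\dots,e_m$ of type $S(r,q,m)$ consisting of edges of $K_d^{(r)}$ with $\sum_{i=1}^m c(e_i)=0$. *)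

theory Defs
  imports Complex_Main
begin

text \<open>A finite abelian group \<open>G\<close> is a type \<open>'g :: {ab_group_add, finite}\<close>; invariants of \<open>G\<close> take
  the argument \<open>TYPE('g)\<close>. The \<open>n\<close>-fold multiple of \<open>g\<close> is written \<open>\<Sum>i<n. g\<close>.\<close>

definition group_exponent :: "'g :: {ab_group_add, finite} itself \<Rightarrow> nat" where
  "group_exponent _ = (LEAST n. 0 < n \<and> (\<forall>g :: 'g. (\<Sum>i<n. g) = 0))"

definition davenport :: "'g :: {ab_group_add, finite} itself \<Rightarrow> nat" where
  "davenport _ = (LEAST d. 0 < d \<and>
     (\<forall>s :: nat \<Rightarrow> 'g. \<exists>I \<subseteq> {..<d}. I \<noteq> {} \<and> (\<Sum>i\<in>I. s i) = 0))"

definition delta_system :: "nat \<Rightarrow> nat \<Rightarrow> nat \<Rightarrow> (nat \<Rightarrow> 'v set) \<Rightarrow> bool" where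
  "delta_system r q m e \<longleftrightarrow> q < r \<and>
     inj_on e {1..m} \<and> (\<forall>i\<in>{1..m}. finite (e i) \<and> card (e i) = r) \<and>
     (\<exists>Q. finite Q \<and> card Q = q \<and> (\<forall>i j. 1 \<le> i \<and> i < j \<and> j \<le> m \<longrightarrow> e i \<inter> e j = Q))"

definition complete_edges :: "nat \<Rightarrow> nat \<Rightarrow> nat set set" where
  "complete_edges r d = {e. e \<subseteq> {..<d} \<and> card e = r}"

text \<open>A colouring is a total function on sets of vertices; only its values on
  \<open>complete_edges r d\<close> matter.\<close>

definition delta_ramsey :: "nat \<Rightarrow> nat \<Rightarrow> nat \<Rightarrow> 'g :: {ab_group_add, finite} itself \<Rightarrow> nat" where
  "delta_ramsey r q m _ = (LEAST d. 0 < d \<and>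
     (\<forall>c :: nat set \<Rightarrow> 'g. \<exists>e. delta_system r q m e \<and>
        (\<forall>i\<in>{1..m}. e i \<in> complete_edges r d) \<and> (\<Sum>i=1..m. c (e i)) = 0))"

text \<open>The minima above are taken over nonempty sets.\<close>

lemma multiple_add: "(\<Sum>i<a + (b :: nat). g) = (\<Sum>i<a. g) + (\<Sum>i<b. (g :: 'g :: ab_group_add))"
  by (induction b) (simp_all add: add.assoc)

lemma multiple_zero_dvd:
  assumes "(\<Sum>i<n. (g :: 'g :: ab_group_add)) = 0" "n dvd (k :: nat)"
  shows "(\<Sum>i<k. g) = 0"
proof -
  obtain t where "k = n * t" using assms(2) by (elim dvdE)
  moreover have "(\<Sum>i<n * t. g) = 0"
    by (induction t) (simp_all add: multiple_add assms(1))
  ultimately show ?thesis by simp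
qed

lemma group_exponent_exists:
  "\<exists>n :: nat. 0 < n \<and> (\<forall>g :: 'g :: {ab_group_add, finite}. (\<Sum>i<n. g) = 0)"
proof -
  have "\<exists>n>0::nat. (\<Sum>i<n. g) = 0" for g :: 'g
  proof -
    have "\<not> inj (\<lambda>n :: nat. \<Sum>i<n. g)"
      using finite_imageD[of "\<lambda>n :: nat. \<Sum>i<n. g" UNIV] by auto
    then obtain a b :: nat where ab: "a < b" "(\<Sum>i<a. g) = (\<Sum>i<b. g)"
      unfolding inj_def by (metis linorder_neqE_nat)
    then have "(\<Sum>i<a + (b - a). g) = (\<Sum>i<a. g)" by simp
    then have "(\<Sum>i<b - a. g) = 0" unfolding multiple_add by simp
    then show ?thesis using ab(1) by (intro exI[of _ "b - a"]) simp
  qed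
  then obtain f where f: "\<And>g :: 'g. 0 < f g \<and> (\<Sum>i<(f g :: nat). g) = 0" by metis
  have "(\<Sum>i<(\<Prod>x\<in>UNIV. f x). g) = 0" for g :: 'g
    by (rule multiple_zero_dvd[where n = "f g"]) (use f in \<open>auto intro: dvd_prodI\<close>)
  moreover have "0 < (\<Prod>x\<in>UNIV. f x)" using f by (simp add: prod_pos)
  ultimately show ?thesis by blast
qed

lemma davenport_exists:
  "\<exists>d. 0 < d \<and> (\<forall>s :: nat \<Rightarrow> 'g :: {ab_group_add, finite}. \<exists>I \<subseteq> {..<d}. I \<noteq> {} \<and> (\<Sum>i\<in>I. s i) = 0)"
proof (rule exI[of _ "card (UNIV :: 'g set)"], intro conjI allI)
  show "0 < card (UNIV :: 'g set)" by (simp add: finite_UNIV_card_ge_0)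
  fix s :: "nat \<Rightarrow> 'g"
  let ?d = "card (UNIV :: 'g set)"
  have "\<not> inj_on (\<lambda>k. \<Sum>i<k. s i) {..?d}"
  proof
    assume "inj_on (\<lambda>k. \<Sum>i<k. s i) {..?d}"
    then have "card {..?d} \<le> ?d" by (intro card_inj_on_le) auto
    then show False by simp
  qed
  then obtain a b where ab: "a < b" "b \<le> ?d" "(\<Sum>i<a. s i) = (\<Sum>i<b. s i)"
    unfolding inj_on_def by (metis atMost_iff linorder_neqE_nat)
  have "{..<b} = {..<a} \<union> {a..<b}" using ab(1) by auto
  then have "(\<Sum>i<b. s i) = (\<Sum>i<a. s i) + (\<Sum>i=a..<b. s i)"
    by (simp add: sum.union_disjoint ivl_disj_int)
  then have "(\<Sum>i=a..<b. s i) = 0" using ab(3) by simp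
  then show "\<exists>I \<subseteq> {..<?d}. I \<noteq> {} \<and> (\<Sum>i\<in>I. s i) = 0"
    using ab(1,2) by (intro exI[of _ "{a..<b}"]) auto
qed

lemma delta_ramsey_exists:
  assumes "q < r" "group_exponent TYPE('g :: {ab_group_add, finite}) dvd m"
  shows "\<exists>d. 0 < d \<and> (\<forall>c :: nat set \<Rightarrow> 'g. \<exists>e. delta_system r q m e \<and>
    (\<forall>i\<in>{1..m}. e i \<in> complete_edges r d) \<and> (\<Sum>i=1..m. c (e i)) = 0)"
proof -
  define N where "N = card (UNIV :: 'g set) * m + 1"
  define B where "B = (\<lambda>k. {..<q} \<union> {q + k * (r - q)..<q + (k + 1) * (r - q)})"
  have B_int: "B a \<inter> B b = {..<q}" if "a < b" for a b
  proof -
    have "(a + 1) * (r - q) \<le> b * (r - q)" using that by (intro mult_right_mono) auto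
    then show ?thesis unfolding B_def by auto
  qed
  have B_card: "card (B k) = r" for k
    unfolding B_def using assms(1)
    by (subst card_Un_disjoint) auto
  have B_edge: "B k \<in> complete_edges r (q + N * (r - q))" if "k < N" for k
  proof -
    have "(k + 1) * (r - q) \<le> N * (r - q)" using that by (intro mult_right_mono) auto
    then show ?thesis unfolding complete_edges_def using B_card by (auto simp: B_def)
  qed
  have B_inj: "a = b" if "B a = B b" for a b
  proof (rule ccontr)
    assume "a \<noteq> b"
    then have "B a = {..<q}" using B_int[of a b] B_int[of b a] that by (cases "a < b") auto
    then show False using B_card[of a] assms(1) by simp
  qed
  have "\<exists>e. delta_system r q m e \<and>
    (\<forall>i\<in>{1..m}. e i \<in> complete_edges r (q + N * (r - q))) \<and> (\<Sum>i=1..m. c (e i)) = 0"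
    for c :: "nat set \<Rightarrow> 'g"
  proof -
    have "\<exists>g. m \<le> card {k\<in>{..<N}. c (B k) = g}"
    proof (rule ccontr)
      assume "\<nexists>g. m \<le> card {k\<in>{..<N}. c (B k) = g}"
      then have "card {k\<in>{..<N}. c (B k) = g} \<le> m" for g by (meson linear)
      then have "(\<Sum>g\<in>UNIV. card {k\<in>{..<N}. c (B k) = g}) \<le> (\<Sum>g\<in>(UNIV :: 'g set). m)"
        by (intro sum_mono) auto
      moreover have "(\<Sum>g\<in>UNIV. card {k\<in>{..<N}. c (B k) = g}) = card (\<Union>g. {k\<in>{..<N}. c (B k) = g})"
        by (intro card_UN_disjoint[symmetric]) auto
      moreover have "(\<Union>g. {k\<in>{..<N}. c (B k) = g}) = {..<N}" by auto
      ultimately show False unfolding N_def by simp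
    qed
    then obtain g where "m \<le> card {k\<in>{..<N}. c (B k) = g}" by blast
    then obtain K where K: "K \<subseteq> {k\<in>{..<N}. c (B k) = g}" "card K = m" "finite K"
      by (rule obtain_subset_with_card_n)
    obtain h where h: "bij_betw h {1..m} K"
      using K(2,3) ex_bij_betw_nat_finite_1 by blast
    have hK: "h i \<in> K" if "i \<in> {1..m}" for i using h that by (auto simp: bij_betw_def)
    have hN: "h i < N \<and> c (B (h i)) = g" if "i \<in> {1..m}" for i
      using hK[OF that] K(1) by blast
    have h_inj: "h i \<noteq> h j" if "i \<in> {1..m}" "j \<in> {1..m}" "i \<noteq> j" for i j
      using inj_onD[OF bij_betw_imp_inj_on[OF h]] that by blast
    have "delta_system r q m (\<lambda>i. B (h i))"
      unfolding delta_system_def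
    proof (intro conjI exI[of _ "{..<q}"] ballI allI impI)
      show "inj_on (\<lambda>i. B (h i)) {1..m}" using h_inj B_inj by (meson inj_onI)
      fix i j assume "1 \<le> i \<and> i < j \<and> j \<le> m"
      then have "h i \<noteq> h j" using h_inj[of i j] by auto
      then show "B (h i) \<inter> B (h j) = {..<q}"
        using B_int[of "h i" "h j"] B_int[of "h j" "h i"] by (cases "h i < h j") auto
    qed (use assms(1) B_card in \<open>auto simp: B_def\<close>)
    moreover have "\<forall>i\<in>{1..m}. B (h i) \<in> complete_edges r (q + N * (r - q))"
      using hN B_edge by blast
    moreover have "(\<Sum>i=1..m. c (B (h i))) = (\<Sum>i=1..m. g)"
      using hN by (intro sum.cong) blast+
    moreover have "(\<Sum>i=1..m. g) = (\<Sum>i<m. g)"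
      by (rule sum.reindex_bij_witness[of _ Suc "\<lambda>i. i - 1"]) auto
    moreover have "(\<Sum>i<m. g) = 0"
    proof (rule multiple_zero_dvd[OF _ assms(2)])
      show "(\<Sum>i<group_exponent TYPE('g). g) = 0"
        using LeastI_ex[OF group_exponent_exists[where ?'g = 'g]] unfolding group_exponent_def by blast
    qed
    ultimately show ?thesis by (intro exI[of _ "\<lambda>i. B (h i)"]) simp
  qed
  moreover have "0 < q + N * (r - q)" using assms(1) by (simp add: N_def)
  ultimately show ?thesis by blast
qed

end

theory Submission
  imports Defs
begin

text \<open>Write \<open>s = r - q\<close>, \<open>n = |G|\<close> and \<open>D = D(G)\<close>. Fixing the core reduces the upper bounds to finding
  \<open>m\<close> disjoint \<open>s\<close>-sets with zero colour sum. On \<open>s * (m + D - 1)\<close> vertices, partition into \<open>s\<close>-sets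
  and apply Gao's theorem to the sequence of their colours. On \<open>s * m + n - 1\<close> vertices with \<open>m > n\<close>,
  split off zero-sum matchings of size \<open>exp G\<close>, which exist because every sequence of length
  \<open>n + exp G - 1\<close> has a zero-sum subsequence of length \<open>exp G\<close>. For \<open>m = n\<close> the bound is
  multiplicative along a chain of subgroups, so it suffices to treat a maximal subgroup \<open>B\<close> of \<open>A\<close>:
  either many disjoint \<open>(s + 1)\<close>-sets see two colours modulo \<open>B\<close> and the choices between them sum to
  everything, or the colouring is nearly constant modulo \<open>B\<close>.\<close>

section \<open>Subgroups\<close>

text \<open>Using the colours of a fixed partition wastes a whole edge for each surplus term, hence
  the factor \<open>s\<close> in \<open>s * (D - 1)\<close>. To waste single vertices, the edges
  must stay adjustable: \<open>s + 1\<close> vertices containing two edges of different colours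
  offer a choice at the price of one vertex. The obstacle is that the set of sums of such choices
  may stop growing once it is periodic under a proper subgroup. Modulo a maximal subgroup
  \<open>B\<close> of \<open>A\<close> this cannot happen: the stabiliser of the set in
  \<open>A\<close> contains \<open>B\<close>, so it is \<open>B\<close> or \<open>A\<close>, and
  each choice adds a coset of \<open>B\<close> until \<open>A\<close> is exhausted. With
  \<open>k = [A : B]\<close>, \<open>k - 1\<close> choices suffice; one further edge, whose colour
  they cancel, brings the number of edges to \<open>k\<close> and the number of vertices to
  \<open>(s + 1) * (k - 1) + s = s * k + k - 1\<close>. When choices are scarce, \<open>k\<close>
  edges of one class modulo \<open>B\<close> have their sum in \<open>B\<close> because
  \<open>k\<close> is the index. Subgroups are sets here, since the descent passes through subgroups
  that are not types.\<close>

definition add_subgroup :: "'g :: ab_group_add set \<Rightarrow> bool" where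
  "add_subgroup B \<longleftrightarrow> 0 \<in> B \<and> (\<forall>x\<in>B. \<forall>y\<in>B. x - y \<in> B)"

lemma add_subgroupD:
  assumes "add_subgroup B"
  shows "0 \<in> B" "x \<in> B \<Longrightarrow> y \<in> B \<Longrightarrow> x - y \<in> B" "x \<in> B \<Longrightarrow> - x \<in> B"
    "x \<in> B \<Longrightarrow> y \<in> B \<Longrightarrow> x + y \<in> B"
proof -
  show zero: "0 \<in> B" and diff: "x \<in> B \<Longrightarrow> y \<in> B \<Longrightarrow> x - y \<in> B" for x y
    using assms by (auto simp: add_subgroup_def)
  show neg: "x \<in> B \<Longrightarrow> - x \<in> B" for x using diff[OF zero, of x] by simp
  show "x \<in> B \<Longrightarrow> y \<in> B \<Longrightarrow> x + y \<in> B" using diff[of x "- y"] neg[of y] by simp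
qed

lemma add_subgroup_sum:
  assumes "add_subgroup B" "\<And>i. i \<in> I \<Longrightarrow> f i \<in> B"
  shows "sum f I \<in> B"
  using assms(2)
  by (induction I rule: infinite_finite_induct) (auto intro: add_subgroupD[OF assms(1)])

lemma add_subgroup_sum_diff:
  assumes "add_subgroup B" "\<And>i. i \<in> I \<Longrightarrow> f i - h i \<in> B"
  shows "sum f I - sum h I \<in> B"
  using add_subgroup_sum[OF assms(1), of I "\<lambda>i. f i - h i"] assms(2) by (simp add: sum_subtractf)

lemma sum_constant_multiple: "finite I \<Longrightarrow> (\<Sum>i\<in>I. g) = (\<Sum>i<card I. (g :: 'g :: ab_group_add))"
  by (induction I rule: finite_induct) (simp_all add: add.commute)

text \<open>A stand-in for the quotient \<open>A / B\<close>: \<open>\<rho>\<close> chooses by a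
  predicate that is the same for congruent elements, so it is constant on cosets. Each element of
  \<open>A\<close> is \<open>\<rho> x + b\<close> in exactly one way, which gives the index.\<close>

lemma coset_representatives:
  fixes A B :: "'g :: {ab_group_add, finite} set"
  assumes "add_subgroup A" "add_subgroup B" "B \<subseteq> A"
  obtains \<rho> where "\<And>x. \<rho> x - x \<in> B" "\<And>x y. x - y \<in> B \<Longrightarrow> \<rho> x = \<rho> y"
    "\<rho> ` A \<subseteq> A" "card A = card (\<rho> ` A) * card B"
proof -
  define \<rho> where "\<rho> x = (SOME y. y - x \<in> B)" for x
  have \<rho>: "\<rho> x - x \<in> B" for x
    unfolding \<rho>_def by (rule someI[of _ x]) (simp add: add_subgroupD[OF assms(2)])
  have eq: "\<rho> x = \<rho> y" if "x - y \<in> B" for x y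
  proof -
    have "z - x \<in> B \<longleftrightarrow> z - y \<in> B" for z
      using add_subgroupD(4)[OF assms(2), of "z - x" "x - y"]
        add_subgroupD(2)[OF assms(2), of "z - y" "x - y"] that by auto
    then show ?thesis unfolding \<rho>_def by simp
  qed
  have \<rho>A: "\<rho> x \<in> A" if "x \<in> A" for x
    using add_subgroupD(4)[OF assms(1), of "\<rho> x - x" x] \<rho>[of x] that assms(3) by auto
  have "bij_betw (\<lambda>(s, b). s + b) (\<rho> ` A \<times> B) A"
  proof (rule bij_betw_imageI)
    show "inj_on (\<lambda>(s, b). s + b) (\<rho> ` A \<times> B)"
    proof (rule inj_onI, clarify)
      fix x y b b' assume *: "x \<in> A" "b \<in> B" "y \<in> A" "b' \<in> B" "\<rho> x + b = \<rho> y + b'"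
      have "\<rho> x = \<rho> y + b' - b" using *(5) by (simp add: eq_diff_eq)
      then have "\<rho> x - \<rho> y = b' - b" by simp
      then have "\<rho> x - \<rho> y \<in> B" using * add_subgroupD[OF assms(2)] by simp
      moreover have "x - y = (\<rho> x - \<rho> y) - (\<rho> x - x) + (\<rho> y - y)" by simp
      ultimately have "x - y \<in> B" using \<rho> add_subgroupD(2,4)[OF assms(2)] by metis
      then have "\<rho> x = \<rho> y" by (rule eq)
      then show "\<rho> x = \<rho> y \<and> b = b'" using *(5) by simp
    qed
    show "(\<lambda>(s, b). s + b) ` (\<rho> ` A \<times> B) = A"
    proof
      show "(\<lambda>(s, b). s + b) ` (\<rho> ` A \<times> B) \<subseteq> A"
        using \<rho>A assms(3) add_subgroupD(4)[OF assms(1)] by auto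
      show "A \<subseteq> (\<lambda>(s, b). s + b) ` (\<rho> ` A \<times> B)"
      proof
        fix x assume "x \<in> A"
        moreover have "- (\<rho> x - x) \<in> B" using \<rho> add_subgroupD(3)[OF assms(2)] by blast
        ultimately show "x \<in> (\<lambda>(s, b). s + b) ` (\<rho> ` A \<times> B)"
          by (intro image_eqI[of _ _ "(\<rho> x, - (\<rho> x - x))"]) auto
      qed
    qed
  qed
  then have "card A = card (\<rho> ` A) * card B"
    using bij_betw_same_card by (metis card_cartesian_product)
  then show ?thesis using that[of \<rho>] \<rho> eq \<rho>A by blast
qed

lemma card_subgroup_pos: "add_subgroup (B :: 'g :: {ab_group_add, finite} set) \<Longrightarrow> 0 < card B"
  using add_subgroupD(1) card_gt_0_iff by fastforce

lemma subgroup_index: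
  fixes A B :: "'g :: {ab_group_add, finite} set"
  assumes "add_subgroup A" "add_subgroup B" "B \<subseteq> A"
  obtains k where "card A = k * card B"
  using coset_representatives[OF assms] by metis

text \<open>Lagrange's theorem in \<open>A / B\<close>. Translation by \<open>g\<close> permutes the
  \<open>k\<close> coset representatives, so their sum changes by the \<open>k\<close>-fold multiple
  of \<open>g\<close> and yet, modulo \<open>B\<close>, not at all.\<close>

lemma index_multiple_in_subgroup:
  fixes A B :: "'g :: {ab_group_add, finite} set"
  assumes "add_subgroup A" "add_subgroup B" "B \<subseteq> A" "card A = k * card B" "g \<in> A"
  shows "(\<Sum>i<k. g) \<in> B"
proof -
  obtain \<rho> where \<rho>: "\<And>x. \<rho> x - x \<in> B" "\<And>x y. x - y \<in> B \<Longrightarrow> \<rho> x = \<rho> y"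
    "\<rho> ` A \<subseteq> A" "card A = card (\<rho> ` A) * card B"
    using coset_representatives[OF assms(1-3)] by metis
  let ?S = "\<rho> ` A"
  have k: "k = card ?S" using \<rho>(4) assms(4) card_subgroup_pos[OF assms(2)] by auto
  have idem: "\<rho> x = x" if "x \<in> ?S" for x using that \<rho>(1,2) by auto
  have inj: "inj_on (\<lambda>x. \<rho> (x + g)) ?S"
  proof (rule inj_onI)
    fix x y assume xy: "x \<in> ?S" "y \<in> ?S" "\<rho> (x + g) = \<rho> (y + g)"
    have "x - y = (\<rho> (y + g) - (y + g)) - (\<rho> (x + g) - (x + g))" using xy(3) by simp
    then have "x - y \<in> B" using \<rho>(1) add_subgroupD(2)[OF assms(2)] by metis
    then show "x = y" using \<rho>(2) idem xy by metis
  qed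
  moreover have "(\<lambda>x. \<rho> (x + g)) ` ?S \<subseteq> ?S"
    using \<rho>(3) assms(5) add_subgroupD(4)[OF assms(1)] by blast
  ultimately have "(\<lambda>x. \<rho> (x + g)) ` ?S = ?S" by (intro endo_inj_surj) auto
  then have "(\<Sum>x\<in>?S. \<rho> (x + g)) = (\<Sum>x\<in>?S. x)" using sum.reindex[OF inj, of "\<lambda>x. x"] by simp
  moreover have "(\<Sum>x\<in>?S. \<rho> (x + g)) - (\<Sum>x\<in>?S. x + g) \<in> B"
    using add_subgroup_sum_diff[OF assms(2), of ?S "\<lambda>x. \<rho> (x + g)" "\<lambda>x. x + g"] \<rho>(1) by blast
  ultimately have "- (\<Sum>x\<in>?S. g) \<in> B" by (simp add: sum.distrib)
  then show ?thesis
    using add_subgroupD(3)[OF assms(2)] sum_constant_multiple[of ?S g] k by fastforce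
qed

section \<open>The exponent of the group\<close>

lemma group_exponent_multiple:
  fixes g :: "'g :: {ab_group_add, finite}"
  shows "0 < group_exponent TYPE('g)" "group_exponent TYPE('g) dvd k \<Longrightarrow> (\<Sum>i<k. g) = 0"
proof -
  have *: "0 < group_exponent TYPE('g) \<and> (\<forall>g :: 'g. (\<Sum>i<group_exponent TYPE('g). g) = 0)"
    using LeastI_ex[OF group_exponent_exists[where ?'g = 'g]] unfolding group_exponent_def by blast
  then show "0 < group_exponent TYPE('g)" by blast
  show "(\<Sum>i<k. g) = 0" if "group_exponent TYPE('g) dvd k"
    using multiple_zero_dvd[OF _ that] * by blast
qed

lemma group_exponent_dvd_card:
  "group_exponent TYPE('g) dvd card (UNIV :: 'g :: {ab_group_add, finite} set)"
proof -
  let ?e = "group_exponent TYPE('g)" and ?n = "card (UNIV :: 'g set)"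
  have "(\<Sum>i<?n mod ?e. g) = 0" for g :: 'g
  proof -
    \<comment> \<open>The subgroup \<open>{0}\<close> has index \<open>?n\<close>. The remainder of
      \<open>?n\<close> modulo the exponent then also annihilates every element, and minimality of
      the exponent forces it to be 0.\<close>
    have "(\<Sum>i<?n. g) \<in> {0}"
      by (rule index_multiple_in_subgroup[where A = UNIV]) (auto simp: add_subgroup_def)
    moreover have "(\<Sum>i<?n. g) = (\<Sum>i<?e * (?n div ?e). g) + (\<Sum>i<?n mod ?e. g)"
      unfolding multiple_add[symmetric] by simp
    moreover have "(\<Sum>i<?e * (?n div ?e). g) = 0" by (rule group_exponent_multiple) simp
    ultimately show ?thesis by simp
  qed
  moreover have "?n mod ?e < ?e" using group_exponent_multiple(1)[where ?'g = 'g] by simp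
  then have "\<not> (0 < ?n mod ?e \<and> (\<forall>g :: 'g. (\<Sum>i<?n mod ?e. g) = 0))"
    unfolding group_exponent_def by (rule not_less_Least)
  ultimately have "?n mod ?e = 0" by simp
  then show ?thesis by (simp add: dvd_eq_mod_eq_0)
qed

section \<open>Zero-sum subsequences\<close>

text \<open>Induction on \<open>card B\<close>. The Dyson transform preserves
  \<open>card A + card B\<close>, shrinks \<open>B\<close>, and creates neither a new sum nor a
  nontrivial way to write 0.\<close>

lemma scherk:
  fixes A B :: "'g :: {ab_group_add, finite} set"
  assumes "0 \<in> A" "0 \<in> B" "\<And>a b. a \<in> A \<Longrightarrow> b \<in> B \<Longrightarrow> a + b = 0 \<Longrightarrow> a = 0 \<and> b = 0"
  shows "card A + card B \<le> card {a + b | a b. a \<in> A \<and> b \<in> B} + 1"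
  using assms
proof (induction "card B" arbitrary: A B rule: less_induct)
  case less
  show ?case
  proof (cases "B = {0}")
    case True
    then have "{a + b | a b. a \<in> A \<and> b \<in> B} = A" by auto
    then show ?thesis using True by simp
  next
    case False
    then obtain b0 where b0: "b0 \<in> B" "b0 \<noteq> 0" using less.prems(2) by blast
    \<comment> \<open>Otherwise translation by \<open>b0\<close> permutes \<open>A\<close>, so some
      \<open>a + b0\<close> is 0 although \<open>b0\<close> is not.\<close>
    have "\<exists>a\<in>A. a + b0 \<notin> A"
    proof (rule ccontr)
      assume "\<not> (\<exists>a\<in>A. a + b0 \<notin> A)"
      then have "(\<lambda>a. a + b0) ` A = A" by (intro endo_inj_surj) auto
      then obtain a where "a \<in> A" "a + b0 = 0" using less.prems(1) by (metis imageE)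
      then show False using less.prems(3) b0 by blast
    qed
    then obtain a0 where a0: "a0 \<in> A" "a0 + b0 \<notin> A" by blast
    \<comment> \<open>the Dyson transform of the pair at \<open>a0\<close>\<close>
    define A' where "A' = A \<union> (+) a0 ` B"
    define B' where "B' = {b \<in> B. a0 + b \<in> A}"
    have "B' \<subset> B" using a0 b0 by (auto simp: B'_def)
    then have lt: "card B' < card B" by (simp add: psubset_card_mono)
    have int: "A \<inter> (+) a0 ` B = (+) a0 ` B'" by (auto simp: B'_def)
    have "card A' + card (A \<inter> (+) a0 ` B) = card A + card ((+) a0 ` B)"
      unfolding A'_def by (rule card_Un_Int[symmetric]) auto
    then have cards: "card A' + card B' = card A + card B"
      unfolding int by (simp add: card_image)
    \<comment> \<open>For a new element \<open>a = a0 + b1\<close>, regroup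
      \<open>(a0 + b1) + b\<close> as \<open>(a0 + b) + b1\<close>; here \<open>a0 + b\<close> lies
      in \<open>A\<close> by the choice of \<open>B'\<close>. The same regrouping shows below that
      no new sum appears.\<close>
    have triv: "a = 0 \<and> b = 0" if ab: "a \<in> A'" "b \<in> B'" "a + b = 0" for a b
    proof (cases "a \<in> A")
      case True
      then show ?thesis using less.prems(3) that by (auto simp: B'_def)
    next
      case False
      then obtain b1 where b1: "b1 \<in> B" "a = a0 + b1" using ab(1) by (auto simp: A'_def)
      have "a0 + b \<in> A" "b \<in> B" using that(2) by (auto simp: B'_def)
      moreover have "(a0 + b) + b1 = 0" using that(3) b1(2) by (simp add: ac_simps)
      ultimately have "a0 + b = 0" "b1 = 0" using less.prems(3) b1(1) by blast+
      then have "a0 = 0 \<and> b = 0" using less.prems(3) a0(1) \<open>b \<in> B\<close> by blast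
      then show ?thesis using b1(2) \<open>b1 = 0\<close> by simp
    qed
    have "card A' + card B' \<le> card {a + b | a b. a \<in> A' \<and> b \<in> B'} + 1"
      using less.prems(1,2) a0(1)
      by (intro less.hyps[OF lt] triv) (auto simp: A'_def B'_def)
    moreover have "card {a + b | a b. a \<in> A' \<and> b \<in> B'} \<le> card {a + b | a b. a \<in> A \<and> b \<in> B}"
    proof (rule card_mono)
      show "{a + b | a b. a \<in> A' \<and> b \<in> B'} \<subseteq> {a + b | a b. a \<in> A \<and> b \<in> B}"
      proof clarify
        fix a b assume ab: "a \<in> A'" "b \<in> B'"
        show "\<exists>a' b'. a + b = a' + b' \<and> a' \<in> A \<and> b' \<in> B"
        proof (cases "a \<in> A")
          case True
          then show ?thesis using ab(2) by (auto simp: B'_def)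
        next
          case False
          then obtain b1 where "b1 \<in> B" "a = a0 + b1" using ab(1) by (auto simp: A'_def)
          moreover have "a0 + b \<in> A" using ab(2) by (auto simp: B'_def)
          ultimately show ?thesis
            by (intro exI[of _ "a0 + b"] exI[of _ b1]) (auto simp: ac_simps)
        qed
      qed
    qed simp
    ultimately show ?thesis using cards by linarith
  qed
qed

text \<open>Splits a sequence of multiplicity at most \<open>h\<close> into \<open>h\<close> label
  classes on which \<open>f\<close> is injective, that is, into \<open>h\<close> sets to which
  sumset bounds apply.\<close>

lemma ex_label_inj_on_fibres:
  fixes f :: "'i \<Rightarrow> 'g :: finite"
  assumes "finite I" "\<And>x. card {i \<in> I. f i = x} \<le> h"
  obtains l :: "'i \<Rightarrow> nat" where "\<And>i. i \<in> I \<Longrightarrow> l i < h"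
    "\<And>i j. i \<in> I \<Longrightarrow> j \<in> I \<Longrightarrow> l i = l j \<Longrightarrow> f i = f j \<Longrightarrow> i = j"
proof -
  have "\<exists>l :: 'i \<Rightarrow> nat. l ` {i \<in> I. f i = x} \<subseteq> {..<h} \<and> inj_on l {i \<in> I. f i = x}" for x
    using inj_on_iff_card_le[of "{i \<in> I. f i = x}" "{..<h}"] assms by auto
  then obtain l :: "'g \<Rightarrow> 'i \<Rightarrow> nat" where
    l: "\<And>x. l x ` {i \<in> I. f i = x} \<subseteq> {..<h} \<and> inj_on (l x) {i \<in> I. f i = x}" by metis
  show ?thesis
  proof (rule that[of "\<lambda>i. l (f i) i"])
    show "l (f i) i < h" if "i \<in> I" for i using l[of "f i"] that by auto
    show "i = j" if "i \<in> I" "j \<in> I" "l (f i) i = l (f j) j" "f i = f j" for i j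
      using l[of "f i"] that by (auto simp: inj_on_def)
  qed
qed

text \<open>Take at most one term from each of \<open>h\<close> label classes, which bounds the
  length by \<open>h\<close>. If no such choice sums to 0, every class enlarges the set of
  attainable sums by its own size, and more than \<open>|G|\<close> sums result.\<close>

lemma short_zero_sum:
  fixes f :: "'i \<Rightarrow> 'g :: {ab_group_add, finite}"
  assumes "finite I" "card (UNIV :: 'g set) \<le> card I" "\<And>x. card {i \<in> I. f i = x} \<le> h"
  obtains J where "J \<subseteq> I" "J \<noteq> {}" "card J \<le> h" "sum f J = 0"
proof -
  obtain l :: "'i \<Rightarrow> nat" where l: "\<And>i. i \<in> I \<Longrightarrow> l i < h"
    "\<And>i j. i \<in> I \<Longrightarrow> j \<in> I \<Longrightarrow> l i = l j \<Longrightarrow> f i = f j \<Longrightarrow> i = j"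
    using ex_label_inj_on_fibres[OF assms(1,3)] by metis
  have "\<exists>J\<subseteq>I. J \<noteq> {} \<and> inj_on l J \<and> sum f J = 0"
  proof (rule ccontr)
    assume "\<not> ?thesis"
    then have free: "sum f J \<noteq> 0" if "J \<subseteq> I" "J \<noteq> {}" "inj_on l J" for J using that by blast
    \<comment> \<open>Sums attainable from the first \<open>k\<close> classes; injectivity of
      \<open>l\<close> on \<open>J\<close> means one term per class at most.\<close>
    define S where "S k = {sum f J | J. J \<subseteq> {i \<in> I. l i < k} \<and> inj_on l J}" for k
    have "card {i \<in> I. l i < k} + 1 \<le> card (S k)" for k
    proof (induction k)
      case 0
      have "0 \<in> S 0" by (auto simp: S_def intro!: exI[of _ "{}"])
      then show ?case using card_gt_0_iff[of "S 0"] by auto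
    next
      case (Suc k)
      let ?L = "{i \<in> I. l i = k}"
      have fi: "f i \<noteq> 0" if "i \<in> I" for i using free[of "{i}"] that by simp
      have join: "insert i J \<subseteq> {i \<in> I. l i < Suc k}" "inj_on l (insert i J)"
          "sum f (insert i J) = sum f J + f i"
        if "J \<subseteq> {i \<in> I. l i < k}" "inj_on l J" "i \<in> ?L" for J i
      proof -
        have "i \<notin> J" "finite J" using that assms(1) by (auto intro: finite_subset)
        then show "sum f (insert i J) = sum f J + f i" by (simp add: add.commute)
        show "insert i J \<subseteq> {i \<in> I. l i < Suc k}" using that by auto
        have "l i \<notin> l ` J" using that by auto
        then show "inj_on l (insert i J)" using that(2) \<open>i \<notin> J\<close> by simp
      qed
      have "card (S k) + card (insert 0 (f ` ?L)) \<le>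
        card {a + b | a b. a \<in> S k \<and> b \<in> insert 0 (f ` ?L)} + 1"
      proof (rule scherk)
        show "0 \<in> S k" by (auto simp: S_def intro!: exI[of _ "{}"])
        fix a b assume ab: "a \<in> S k" "b \<in> insert 0 (f ` ?L)" "a + b = 0"
        show "a = 0 \<and> b = 0"
        proof (cases "b = 0")
          case False
          then obtain i where i: "i \<in> ?L" "b = f i" using ab(2) by blast
          obtain J where J: "J \<subseteq> {i \<in> I. l i < k}" "inj_on l J" "a = sum f J"
            using ab(1) by (auto simp: S_def)
          have "sum f (insert i J) \<noteq> 0" using join[OF J(1,2) i(1)] by (intro free) auto
          then show ?thesis using join(3)[OF J(1,2) i(1)] J(3) i(2) ab(3) by simp
        qed (use ab in auto)
      qed simp
      moreover have "{a + b | a b. a \<in> S k \<and> b \<in> insert 0 (f ` ?L)} \<subseteq> S (Suc k)"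
      proof clarify
        fix a b assume ab: "a \<in> S k" "b \<in> insert 0 (f ` ?L)"
        obtain J where J: "J \<subseteq> {i \<in> I. l i < k}" "inj_on l J" "a = sum f J"
          using ab(1) by (auto simp: S_def)
        show "a + b \<in> S (Suc k)"
        proof (cases "b = 0")
          case True
          moreover have "J \<subseteq> {i \<in> I. l i < Suc k}" using J(1) by auto
          ultimately show ?thesis using J by (auto simp: S_def)
        next
          case False
          then obtain i where i: "i \<in> ?L" "b = f i" using ab(2) by blast
          have "a + b = sum f (insert i J)" using join(3)[OF J(1,2) i(1)] J(3) i(2) by simp
          then show ?thesis using join(1,2)[OF J(1,2) i(1)] unfolding S_def by blast
        qed
      qed
      then have "card {a + b | a b. a \<in> S k \<and> b \<in> insert 0 (f ` ?L)} \<le> card (S (Suc k))"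
        by (intro card_mono) auto
      \<comment> \<open>The 0 stands for skipping the class. It makes up for the 1 lost in the
        sumset bound.\<close>
      moreover have "card (insert 0 (f ` ?L)) = card ?L + 1"
      proof -
        have "inj_on f ?L" using l(2) by (auto intro!: inj_onI)
        moreover have "0 \<notin> f ` ?L" using fi by force
        ultimately show ?thesis using assms(1) by (simp add: card_image)
      qed
      moreover have "card {i \<in> I. l i < Suc k} = card {i \<in> I. l i < k} + card ?L"
      proof -
        have "{i \<in> I. l i < Suc k} = {i \<in> I. l i < k} \<union> ?L" by auto
        then show ?thesis using assms(1) by (auto intro!: card_Un_disjoint)
      qed
      ultimately show ?case using Suc.IH by linarith
    qed
    from this[of h] have "card I + 1 \<le> card (S h)"
      using l(1) by (simp add: Collect_conj_eq Int_absorb2 subset_eq)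
    also have "\<dots> \<le> card (UNIV :: 'g set)" by (intro card_mono) auto
    finally show False using assms(2) by simp
  qed
  then obtain J where J: "J \<subseteq> I" "J \<noteq> {}" "inj_on l J" "sum f J = 0" by blast
  have "card J \<le> card {..<h}" using J l(1) by (intro card_inj_on_le[of l]) auto
  then show ?thesis using that J by simp
qed

section \<open>Zero-sum subsequences of prescribed length\<close>

lemma zero_sum_pad:
  fixes f :: "'i \<Rightarrow> 'g :: {ab_group_add, finite}"
  assumes "finite I" "J \<subseteq> I" "\<And>i. i \<in> J \<Longrightarrow> f i \<noteq> 0" "sum f J = 0"
    "card J \<le> k" "k \<le> card J + card {i \<in> I. f i = 0}"
  obtains J' where "J' \<subseteq> I" "card J' = k" "sum f J' = 0"
proof -
  have "k - card J \<le> card {i \<in> I. f i = 0}" using assms(5,6) by linarith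
  then obtain Z where Z: "Z \<subseteq> {i \<in> I. f i = 0}" "card Z = k - card J" "finite Z"
    by (rule obtain_subset_with_card_n)
  have disj: "J \<inter> Z = {}" "finite J" using assms(1-3) Z(1) by (auto intro: finite_subset)
  have "sum f Z = 0" using Z(1) by (intro sum.neutral) auto
  then have "sum f (J \<union> Z) = 0" using disj Z assms(4) by (simp add: sum.union_disjoint)
  moreover have "card (J \<union> Z) = k" using disj Z assms(5) by (simp add: card_Un_disjoint)
  moreover have "J \<union> Z \<subseteq> I" using assms(2) Z(1) by auto
  ultimately show ?thesis using that by blast
qed

text \<open>Permits shifting the most frequent value to 0: the shift contributes a multiple of
  \<open>g\<close> that the exponent kills.\<close>

lemma zero_sum_of_translate:
  fixes f :: "'i \<Rightarrow> 'g :: {ab_group_add, finite}"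
  assumes "group_exponent TYPE('g) dvd card J" "finite J" "(\<Sum>i\<in>J. f i - g) = 0"
  shows "sum f J = 0"
  using assms sum_constant_multiple[of J g] group_exponent_multiple(2)[of "card J" g]
  by (simp add: sum_subtractf)

lemma ex_most_frequent_value:
  fixes f :: "'i \<Rightarrow> 'g :: finite"
  obtains g where "\<And>x. card {i \<in> I. f i = x} \<le> card {i \<in> I. f i = g}"
proof -
  let ?C = "range (\<lambda>x. card {i \<in> I. f i = x})"
  have "Max ?C \<in> ?C" by (intro Max_in) auto
  then obtain g where g: "Max ?C = card {i \<in> I. f i = g}" by blast
  have "card {i \<in> I. f i = x} \<le> card {i \<in> I. f i = g}" for x
    unfolding g[symmetric] by (intro Max_ge) auto
  then show ?thesis using that by blast
qed

text \<open>After the shift there are \<open>h\<close> zeros. A longest zero-sum set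
  \<open>W\<close> of nonzero terms with at most \<open>exp G\<close> elements misses that length by
  at most \<open>h\<close>: otherwise a further piece of length at most \<open>h\<close> could be
  added without overshooting. Zeros fill the gap.\<close>

lemma zero_sum_of_exponent_length:
  fixes f :: "'i \<Rightarrow> 'g :: {ab_group_add, finite}"
  assumes "finite I" "card (UNIV :: 'g set) + group_exponent TYPE('g) - 1 \<le> card I"
  obtains J where "J \<subseteq> I" "card J = group_exponent TYPE('g)" "sum f J = 0"
proof -
  let ?e = "group_exponent TYPE('g)"
  obtain g where g: "\<And>x. card {i \<in> I. f i = x} \<le> card {i \<in> I. f i = g}"
    using ex_most_frequent_value[of I f] by metis
  define f' where "f' i = f i - g" for i
  define h where "h = card {i \<in> I. f' i = 0}"
  define T where "T = {i \<in> I. f' i \<noteq> 0}"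
  have f'_fibre: "card {i \<in> I. f' i = x} \<le> h" for x
    using g[of "x + g"] by (simp add: f'_def h_def diff_eq_eq)
  have T_card: "card T + h = card I"
  proof -
    have "I = T \<union> {i \<in> I. f' i = 0}" by (auto simp: T_def)
    moreover have "T \<inter> {i \<in> I. f' i = 0} = {}" by (auto simp: T_def)
    ultimately show ?thesis
      unfolding h_def using assms(1) by (metis card_Un_disjoint finite_Un)
  qed
  let ?P = "\<lambda>J. J \<subseteq> T \<and> sum f' J = 0 \<and> card J \<le> ?e"
  have finT: "finite T" using assms(1) by (simp add: T_def)
  have "\<exists>J. ?P J \<and> (\<forall>J'. ?P J' \<longrightarrow> card J' \<le> card J)"
    by (rule ex_has_greatest_nat[of ?P "{}" card "Suc ?e"]) auto
  then obtain W where W: "?P W" "\<And>J'. ?P J' \<Longrightarrow> card J' \<le> card W" by blast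
  have finW: "finite W" using W(1) finT finite_subset by blast
  have "?e \<le> card W + h"
  proof (rule ccontr)
    assume neg: "\<not> ?e \<le> card W + h"
    have "card (T - W) = card T - card W" using W(1) finT finW by (simp add: card_Diff_subset)
    \<comment> \<open>The zeros and \<open>W\<close> together use at most \<open>exp G - 1\<close>
      terms, which is where the length \<open>|G| + exp G - 1\<close> comes from.\<close>
    then have big: "card (UNIV :: 'g set) \<le> card (T - W)" using T_card assms(2) neg by linarith
    have "card {i \<in> T - W. f' i = x} \<le> h" for x
      using f'_fibre[of x] card_mono[of "{i \<in> I. f' i = x}" "{i \<in> T - W. f' i = x}"] assms(1)
      by (fastforce simp: T_def)
    then obtain J where J: "J \<subseteq> T - W" "J \<noteq> {}" "card J \<le> h" "sum f' J = 0"
      using short_zero_sum[of "T - W" f' h] big finT by blast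
    have finJ: "finite J" using J(1) finT finite_subset by blast
    have "W \<inter> J = {}" using J(1) by blast
    then have "card (W \<union> J) = card W + card J" "sum f' (W \<union> J) = 0"
      using finW finJ J W(1) by (auto simp: card_Un_disjoint sum.union_disjoint)
    moreover from this have "card (W \<union> J) \<le> card W"
      using W(1) J neg by (intro W(2)) auto
    ultimately show False using J(2) finJ by simp
  qed
  then obtain J where J: "J \<subseteq> I" "card J = ?e" "sum f' J = 0"
    using zero_sum_pad[of I W f' ?e] W(1) assms(1) unfolding h_def T_def by blast
  then have "sum f J = 0"
    using zero_sum_of_translate[of J f g] finite_subset[OF J(1) assms(1)] by (simp add: f'_def)
  then show ?thesis using that J by blast
qed

lemma davenport_zero_sum:
  fixes f :: "'i \<Rightarrow> 'g :: {ab_group_add, finite}"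
  assumes "finite I" "davenport TYPE('g) \<le> card I"
  obtains J where "J \<subseteq> I" "J \<noteq> {}" "sum f J = 0"
proof -
  obtain \<beta> where \<beta>: "bij_betw \<beta> {..<card I} I"
    using ex_bij_betw_nat_finite[OF assms(1)] by (metis atLeast0LessThan)
  obtain K where K: "K \<subseteq> {..<davenport TYPE('g)}" "K \<noteq> {}" "(\<Sum>i\<in>K. f (\<beta> i)) = 0"
    using LeastI_ex[OF davenport_exists[where ?'g = 'g]] unfolding davenport_def by meson
  have "K \<subseteq> {..<card I}" using K(1) assms(2) by force
  then have "inj_on \<beta> K" "\<beta> ` K \<subseteq> I" using \<beta> by (auto simp: bij_betw_def inj_on_subset)
  then show ?thesis using that[of "\<beta> ` K"] K by (simp add: sum.reindex)
qed

text \<open>Outside a largest zero-sum subsequence no nonempty zero-sum remains, so fewer than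
  \<open>D\<close> terms do.\<close>

lemma ex_large_zero_sum:
  fixes f :: "'i \<Rightarrow> 'g :: {ab_group_add, finite}"
  assumes "finite I"
  obtains J where "J \<subseteq> I" "sum f J = 0" "card I < card J + davenport TYPE('g)"
proof -
  let ?P = "\<lambda>J. J \<subseteq> I \<and> sum f J = 0"
  have "\<exists>J. ?P J \<and> (\<forall>J'. ?P J' \<longrightarrow> card J' \<le> card J)"
    by (rule ex_has_greatest_nat[of ?P "{}" card "Suc (card I)"]) (auto intro!: le_imp_less_Suc card_mono assms)
  then obtain W where W: "?P W" "\<And>J'. ?P J' \<Longrightarrow> card J' \<le> card W" by blast
  have finW: "finite W" using W(1) assms finite_subset by blast
  have "card (I - W) < davenport TYPE('g)"
  proof (rule ccontr)
    assume "\<not> ?thesis"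
    then obtain J where J: "J \<subseteq> I - W" "J \<noteq> {}" "sum f J = 0"
      using davenport_zero_sum[of "I - W" f] assms by auto
    have finJ: "finite J" using J(1) assms finite_subset by blast
    have "W \<inter> J = {}" using J(1) by blast
    then have "card (W \<union> J) = card W + card J" "sum f (W \<union> J) = 0"
      using finW finJ J W(1) by (auto simp: card_Un_disjoint sum.union_disjoint)
    moreover from this have "card (W \<union> J) \<le> card W" using W(1) J by (intro W(2)) auto
    ultimately show False using J(2) finJ by simp
  qed
  then have "card I < card W + davenport TYPE('g)"
    using W(1) finW assms card_mono by (fastforce simp: card_Diff_subset)
  then show ?thesis using that W(1) by blast
qed

text \<open>Gao's theorem. After translating so that 0 is the most frequent value, a longest zero-sum
  subsequence is long enough; its nonzero part is shortened by pieces no longer than the number of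
  zeros, so the window reachable by padding with zeros is not skipped.\<close>

lemma gao_zero_sum:
  fixes f :: "'i \<Rightarrow> 'g :: {ab_group_add, finite}"
  assumes "finite I" "m + davenport TYPE('g) - 1 \<le> card I" "card (UNIV :: 'g set) \<le> m"
    "group_exponent TYPE('g) dvd m"
  obtains J where "J \<subseteq> I" "card J = m" "sum f J = 0"
proof -
  obtain g where g: "\<And>x. card {i \<in> I. f i = x} \<le> card {i \<in> I. f i = g}"
    using ex_most_frequent_value[of I f] by metis
  define f' where "f' i = f i - g" for i
  define h where "h = card {i \<in> I. f' i = 0}"
  have f'_fibre: "card {i \<in> I. f' i = x} \<le> h" for x
    using g[of "x + g"] by (simp add: f'_def h_def diff_eq_eq)
  obtain U where U: "U \<subseteq> I" "sum f' U = 0" "card I < card U + davenport TYPE('g)"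
    using ex_large_zero_sum[OF assms(1), of f'] by metis
  have finU: "finite U" using U(1) assms(1) finite_subset by blast
  let ?P = "\<lambda>J. J \<subseteq> {i \<in> I. f' i \<noteq> 0} \<and> sum f' J = 0 \<and> m \<le> card J + h"
  have "?P {i \<in> U. f' i \<noteq> 0}"
  proof (intro conjI)
    have "sum f' {i \<in> U. f' i \<noteq> 0} = sum f' U"
      by (rule sum.mono_neutral_left[OF finU]) auto
    then show "sum f' {i \<in> U. f' i \<noteq> 0} = 0" using U(2) by simp
    have "U \<subseteq> {i \<in> U. f' i \<noteq> 0} \<union> {i \<in> I. f' i = 0}" using U(1) by auto
    then have "card U \<le> card ({i \<in> U. f' i \<noteq> 0} \<union> {i \<in> I. f' i = 0})"
      using assms(1) finU by (intro card_mono) auto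
    also have "\<dots> \<le> card {i \<in> U. f' i \<noteq> 0} + h" unfolding h_def by (rule card_Un_le)
    finally show "m \<le> card {i \<in> U. f' i \<noteq> 0} + h" using U(3) assms(2) by linarith
  qed (use U(1) in auto)
  from ex_has_least_nat[of ?P, OF this, of card]
  obtain V where V: "?P V" "\<And>J. ?P J \<Longrightarrow> card V \<le> card J" by blast
  have finV: "finite V" using V(1) assms(1) by (auto intro: finite_subset)
  have "card V \<le> m"
  proof (rule ccontr)
    assume neg: "\<not> card V \<le> m"
    have "card {i \<in> V. f' i = x} \<le> h" for x
      using f'_fibre[of x] card_mono[of "{i \<in> I. f' i = x}" "{i \<in> V. f' i = x}"] assms(1) V(1)
      by fastforce
    moreover have "card (UNIV :: 'g set) \<le> card V" using neg assms(3) by linarith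
    ultimately obtain J where J: "J \<subseteq> V" "J \<noteq> {}" "card J \<le> h" "sum f' J = 0"
      using short_zero_sum[of V f' h] finV by blast
    have finJ: "finite J" using J(1) finV finite_subset by blast
    have "sum f' (V - J) = 0" using J V(1) finV by (simp add: sum_diff)
    moreover have c: "card (V - J) = card V - card J" using J(1) finJ by (simp add: card_Diff_subset)
    ultimately have "card V \<le> card (V - J)" using V(1) neg J(3) by (intro V(2)) auto
    moreover have "0 < card J" using J(2) finJ by (simp add: card_gt_0_iff)
    ultimately show False using c neg by linarith
  qed
  then obtain J where J: "J \<subseteq> I" "card J = m" "sum f' J = 0"
    using zero_sum_pad[of I V f' m] V(1) assms(1) unfolding h_def by blast
  then have "sum f J = 0"
    using zero_sum_of_translate[of J f g] finite_subset[OF J(1) assms(1)] assms(4)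
    by (simp add: f'_def)
  then show ?thesis using that J by blast
qed

section \<open>Matchings of uniform hypergraphs\<close>

text \<open>A set of edges cannot hold the empty edge twice; lemmas that keep count of edges when
  matchings are joined therefore assume \<open>0 < s\<close>.\<close>

definition uniform_matching :: "nat \<Rightarrow> 'v set \<Rightarrow> 'v set set \<Rightarrow> bool" where
  "uniform_matching s V M \<longleftrightarrow> pairwise disjnt M \<and> (\<forall>e\<in>M. e \<subseteq> V \<and> card e = s)"

lemma uniform_matchingD:
  assumes "uniform_matching s V M" "finite V"
  shows "finite M" "card (\<Union> M) = s * card M" "\<Union> M \<subseteq> V"
proof -
  have "M \<subseteq> Pow V" using assms(1) by (auto simp: uniform_matching_def)
  then show "finite M" using assms(2) by (meson finite_Pow_iff finite_subset)
  show "\<Union> M \<subseteq> V" using \<open>M \<subseteq> Pow V\<close> by blast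
  have "card (\<Union> M) = sum card M"
    using assms finite_subset by (intro card_Union_disjoint) (auto simp: uniform_matching_def)
  also have "\<dots> = s * card M" using assms(1) by (simp add: uniform_matching_def)
  finally show "card (\<Union> M) = s * card M" .
qed

lemma uniform_matching_mono:
  "uniform_matching s V M \<Longrightarrow> M' \<subseteq> M \<Longrightarrow> V \<subseteq> V' \<Longrightarrow> uniform_matching s V' M'"
  unfolding uniform_matching_def by (meson pairwise_subset subset_iff subset_trans)

lemma uniform_matching_Un:
  assumes "uniform_matching s V M" "uniform_matching s V' M'" "V \<inter> V' = {}" "0 < s"
  shows "uniform_matching s (V \<union> V') (M \<union> M')" "M \<inter> M' = {}"
proof -
  have "disjnt e e'" if "e \<in> M" "e' \<in> M'" for e e'
    using that assms(1-3) by (fastforce simp: uniform_matching_def disjnt_def)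
  then have "disjnt e e'" if "e \<in> M \<union> M'" "e' \<in> M \<union> M'" "e \<noteq> e'" for e e'
    using assms(1,2) that by (metis Un_iff disjnt_sym pairwiseD uniform_matching_def)
  moreover have "\<forall>e\<in>M \<union> M'. e \<subseteq> V \<union> V' \<and> card e = s"
    using assms(1,2) by (auto simp: uniform_matching_def)
  ultimately show "uniform_matching s (V \<union> V') (M \<union> M')"
    unfolding uniform_matching_def pairwise_def by simp
  show "M \<inter> M' = {}"
  proof (rule ccontr)
    assume "M \<inter> M' \<noteq> {}"
    then obtain e where "e \<in> M" "e \<in> M'" by blast
    then have "e \<subseteq> V \<inter> V'" "card e = s" using assms(1,2) by (auto simp: uniform_matching_def)
    then show False using assms(3,4) by simp
  qed
qed

lemma uniform_matching_insert:
  assumes "uniform_matching s V M" "e \<subseteq> V" "card e = s" "e \<inter> \<Union> M = {}" "0 < s"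
  shows "uniform_matching s V (insert e M)" "e \<notin> M"
proof -
  have "uniform_matching s e {e}" using assms(3) by (simp add: uniform_matching_def)
  moreover have "uniform_matching s (\<Union> M) M" using assms(1) by (auto simp: uniform_matching_def)
  ultimately have *: "uniform_matching s (e \<union> \<Union> M) ({e} \<union> M)" "{e} \<inter> M = {}"
    using uniform_matching_Un[of s e "{e}" "\<Union> M" M] assms(4,5) by auto
  have "e \<union> \<Union> M \<subseteq> V" using assms(1,2) by (auto simp: uniform_matching_def)
  then show "uniform_matching s V (insert e M)" using uniform_matching_mono[OF *(1)] by simp
  show "e \<notin> M" using *(2) by simp
qed

lemma ex_uniform_matching:
  assumes "finite V" "0 < s" "s * k \<le> card V"
  obtains M where "uniform_matching s V M" "card M = k"
proof -
  have "\<exists>M. uniform_matching s V M \<and> card M = k"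
    using assms(1,3)
  proof (induction k arbitrary: V)
    case 0
    then show ?case by (intro exI[of _ "{}"]) (simp add: uniform_matching_def)
  next
    case (Suc k)
    obtain e where e: "e \<subseteq> V" "card e = s" "finite e"
      using obtain_subset_with_card_n[of s V] Suc.prems(2) by auto
    have "s * k \<le> card (V - e)" using e Suc.prems by (simp add: card_Diff_subset)
    then obtain M where M: "uniform_matching s (V - e) M" "card M = k"
      using Suc.IH[of "V - e"] Suc.prems(1) by auto
    have "uniform_matching s V M" using uniform_matching_mono[OF M(1)] by blast
    moreover have "e \<inter> \<Union> M = {}" using M(1) by (auto simp: uniform_matching_def)
    ultimately have "uniform_matching s V (insert e M)" "e \<notin> M"
      using uniform_matching_insert[of s V M e] e(1,2) assms(2) by auto
    moreover have "finite M" using uniform_matchingD(1)[OF M(1)] Suc.prems(1) by simp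
    ultimately show ?case using M(2) by (intro exI[of _ "insert e M"]) simp
  qed
  then show ?thesis using that by blast
qed

lemma uniform_matching_image:
  assumes "uniform_matching t V F" "\<And>K. K \<in> F \<Longrightarrow> \<phi> K \<subseteq> K \<and> card (\<phi> K) = s" "0 < s"
  shows "uniform_matching s (\<Union> F) (\<phi> ` F)" "inj_on \<phi> F"
proof -
  have disj: "disjnt (\<phi> K) (\<phi> K')" if "K \<in> F" "K' \<in> F" "K \<noteq> K'" for K K'
  proof -
    have "disjnt K K'" using assms(1) that by (auto simp: uniform_matching_def pairwise_def)
    then show ?thesis using assms(2) that by (meson disjnt_subset1 disjnt_subset2)
  qed
  then show "uniform_matching s (\<Union> F) (\<phi> ` F)"
    using assms(2) unfolding uniform_matching_def pairwise_def by blast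
  show "inj_on \<phi> F"
  proof (rule inj_onI, rule ccontr)
    fix K K' assume K: "K \<in> F" "K' \<in> F" "\<phi> K = \<phi> K'" "K \<noteq> K'"
    then have "\<phi> K = {}" using disj[OF K(1,2,4)] by (simp add: disjnt_def)
    then show False using assms(2)[OF K(1)] assms(3) by simp
  qed
qed

text \<open>A discrete intermediate value argument: on the way from \<open>e\<close> to
  \<open>e'\<close> by exchanges of one vertex, \<open>P\<close> must switch on. The switch is found
  at a set violating \<open>P\<close> with largest overlap with \<open>e'\<close>.\<close>

lemma ex_adjacent_sets:
  assumes "finite e" "card e = s" "\<not> P e" "finite e'" "card e' = s" "P e'"
  obtains f f' where "f \<subseteq> e \<union> e'" "f' \<subseteq> e \<union> e'" "card f = s" "card f' = s"
    "card (f \<union> f') = Suc s" "\<not> P f" "P f'"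
proof -
  let ?Q = "\<lambda>f. f \<subseteq> e \<union> e' \<and> card f = s \<and> \<not> P f"
  have "\<exists>f. ?Q f \<and> (\<forall>f'. ?Q f' \<longrightarrow> card (f' \<inter> e') \<le> card (f \<inter> e'))"
  proof (rule ex_has_greatest_nat[of ?Q e _ "Suc s"])
    show "\<forall>f. ?Q f \<longrightarrow> card (f \<inter> e') < Suc s"
      using card_mono[OF assms(4) Int_lower2] assms(5) by (simp add: less_Suc_eq_le)
  qed (use assms in auto)
  then obtain f where f: "?Q f" "\<And>f'. ?Q f' \<Longrightarrow> card (f' \<inter> e') \<le> card (f \<inter> e')" by blast
  have finf: "finite f" using f(1) assms(1,4) by (meson finite_UnI finite_subset)
  have "f \<noteq> e'" using f(1) assms(6) by blast
  have "\<not> e' \<subseteq> f" using \<open>f \<noteq> e'\<close> card_subset_eq[OF finf, of e'] f(1) assms(5) by auto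
  then obtain y where y: "y \<in> e'" "y \<notin> f" by blast
  have "\<not> f \<subseteq> e'" using \<open>f \<noteq> e'\<close> card_subset_eq[OF assms(4), of f] f(1) assms(5) by auto
  then obtain x where x: "x \<in> f" "x \<notin> e'" by blast
  let ?f' = "insert y (f - {x})"
  have "f \<union> ?f' = insert y f" using x by blast
  then have "card (f \<union> ?f') = Suc s" using finf y f(1) by simp
  have c: "card ?f' = s" using finf x(1) y f(1) card_Suc_Diff1[of f x] by simp
  have sub: "?f' \<subseteq> e \<union> e'" using f(1) y(1) by blast
  have "?f' \<inter> e' = insert y (f \<inter> e')" using x y by blast
  then have "card (?f' \<inter> e') = Suc (card (f \<inter> e'))" using y finf by simp
  then have "P ?f'" using f(2)[of ?f'] c sub by auto
  then show ?thesis using that[of f ?f'] f(1) c sub \<open>card (f \<union> ?f') = Suc s\<close> by blast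
qed

section \<open>Matchings with sum in a subgroup\<close>

text \<open>If the translates coincide, \<open>a - b\<close> lies in the stabiliser \<open>C\<close>
  of \<open>X\<close> in \<open>A\<close>, which is then strictly larger than \<open>B\<close>, so
  \<open>C = A\<close> and \<open>X = A\<close>. If they differ, both are unions of cosets of
  \<open>B\<close>, so the second contributes an entire new coset.\<close>

lemma card_add_two_translates:
  fixes A B X :: "'g :: {ab_group_add, finite} set"
  assumes "add_subgroup A" "add_subgroup B"
    and maximal: "\<forall>C. add_subgroup C \<longrightarrow> B \<subseteq> C \<longrightarrow> C \<subseteq> A \<longrightarrow> C = B \<or> C = A"
    and "B \<subseteq> A" "X \<subseteq> A" "X \<noteq> {}" and X_inv: "\<forall>x\<in>X. \<forall>b\<in>B. x + b \<in> X"
    and "a \<in> A" "b \<in> A" "a - b \<notin> B"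
  shows "X = A \<or> card X + card B \<le> card ((+) a ` X \<union> (+) b ` X)"
proof (cases "(+) a ` X = (+) b ` X")
  case True
  define C where "C = {d \<in> A. (+) d ` X = X}"
  have shift: "(+) (x - y) ` X = X" if "(+) x ` X = (+) y ` X" for x y
  proof -
    have "(+) (x - y) ` X = (+) (- y) ` (+) x ` X" by (auto simp: image_image algebra_simps)
    also have "\<dots> = (+) (- y) ` (+) y ` X" using that by simp
    also have "\<dots> = X" by (simp add: image_image)
    finally show ?thesis .
  qed
  have "add_subgroup C"
    unfolding add_subgroup_def C_def using add_subgroupD[OF assms(1)] shift by auto
  moreover have "B \<subseteq> C"
  proof
    fix d assume "d \<in> B"
    then have "(+) d ` X \<subseteq> X" using X_inv by (auto simp: add.commute)
    then have "(+) d ` X = X" by (intro endo_inj_surj) auto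
    then show "d \<in> C" using \<open>d \<in> B\<close> \<open>B \<subseteq> A\<close> by (auto simp: C_def)
  qed
  moreover have "C \<subseteq> A" by (auto simp: C_def)
  moreover have "a - b \<in> C"
    using shift[OF True] add_subgroupD(2)[OF assms(1)] \<open>a \<in> A\<close> \<open>b \<in> A\<close> by (simp add: C_def)
  ultimately have CA: "C = A" using maximal \<open>a - b \<notin> B\<close> by blast
  obtain x0 where x0: "x0 \<in> X" using \<open>X \<noteq> {}\<close> by blast
  have "y \<in> X" if "y \<in> A" for y
  proof -
    have "y - x0 \<in> C" using CA that x0 \<open>X \<subseteq> A\<close> add_subgroupD(2)[OF assms(1)] by blast
    then have "(y - x0) + x0 \<in> X" using x0 unfolding C_def by blast
    then show ?thesis by simp
  qed
  then show ?thesis using \<open>X \<subseteq> A\<close> by blast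
next
  case False
  have "card ((+) b ` X) = card ((+) a ` X)" by (simp add: card_image)
  then have "\<not> (+) b ` X \<subseteq> (+) a ` X" using False card_subset_eq[of "(+) a ` X" "(+) b ` X"] by auto
  then obtain y where y: "y \<in> (+) b ` X" "y \<notin> (+) a ` X" by blast
  have b_inv: "y + d \<in> (+) b ` X" if "d \<in> B" for d
    using y(1) X_inv that by (auto simp: add.assoc)
  have a_inv: "y + d \<notin> (+) a ` X" if "d \<in> B" for d
  proof
    assume "y + d \<in> (+) a ` X"
    then obtain x where x: "x \<in> X" "y + d = a + x" by blast
    have "y = (a + x) - d" using x(2)[symmetric] by simp
    then have "y = a + (x + - d)" by (simp add: add_diff_eq)
    moreover have "x + - d \<in> X" using X_inv x(1) add_subgroupD(3)[OF assms(2) that] by blast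
    ultimately show False using y(2) by blast
  qed
  have "(+) a ` X \<inter> (+) y ` B = {}"
  proof (rule equals0I)
    fix z assume "z \<in> (+) a ` X \<inter> (+) y ` B"
    then obtain d where "d \<in> B" "z = y + d" "z \<in> (+) a ` X" by blast
    then show False using a_inv by blast
  qed
  then have "card ((+) a ` X \<union> (+) y ` B) = card ((+) a ` X) + card ((+) y ` B)"
    by (simp add: card_Un_disjoint)
  also have "\<dots> = card X + card B" by (simp add: card_image)
  finally have "card X + card B = card ((+) a ` X \<union> (+) y ` B)" by simp
  also have "\<dots> \<le> card ((+) a ` X \<union> (+) b ` X)" using b_inv by (intro card_mono) auto
  finally show ?thesis by blast
qed

text \<open>A Cauchy-Davenport argument for two-element sets modulo \<open>B\<close>. The inductive
  set \<open>X\<close> is a union of cosets of \<open>B\<close>, all reached by choice sums; it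
  starts as \<open>B\<close> and gains a coset for each \<open>K\<close> until it is
  \<open>A\<close>.\<close>

lemma choice_sums_cover:
  fixes A B :: "'g :: {ab_group_add, finite} set"
  assumes "add_subgroup A" "add_subgroup B"
    and maximal: "\<forall>C. add_subgroup C \<longrightarrow> B \<subseteq> C \<longrightarrow> C \<subseteq> A \<longrightarrow> C = B \<or> C = A"
    and "B \<subseteq> A" "finite F" "card A \<le> (card F + 1) * card B"
    and ab: "\<forall>K\<in>F. a K \<in> A \<and> b K \<in> A \<and> a K - b K \<notin> B"
    and "x \<in> A"
  obtains \<phi> where "x - (\<Sum>K\<in>F. if \<phi> K then a K else b K) \<in> B"
proof -
  have "\<exists>X. X \<subseteq> A \<and> X \<noteq> {} \<and> (\<forall>x\<in>X. \<forall>d\<in>B. x + d \<in> X) \<and>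
      (X = A \<or> (card F + 1) * card B \<le> card X) \<and>
      (\<forall>x\<in>X. \<exists>\<phi>. x - (\<Sum>K\<in>F. if \<phi> K then a K else b K) \<in> B)"
    using \<open>finite F\<close> ab
  proof (induction F rule: finite_induct)
    case empty
    then show ?case
      using \<open>B \<subseteq> A\<close> add_subgroupD[OF assms(2)] by (intro exI[of _ B]) auto
  next
    case (insert K F)
    obtain X where X: "X \<subseteq> A" "X \<noteq> {}" "\<forall>x\<in>X. \<forall>d\<in>B. x + d \<in> X"
      "X = A \<or> (card F + 1) * card B \<le> card X"
      "\<forall>x\<in>X. \<exists>\<phi>. x - (\<Sum>K\<in>F. if \<phi> K then a K else b K) \<in> B"
      using insert.IH insert.prems by blast
    have abK: "a K \<in> A" "b K \<in> A" "a K - b K \<notin> B" using insert.prems by auto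
    let ?Y = "(+) (a K) ` X \<union> (+) (b K) ` X"
    have YA: "?Y \<subseteq> A" using X(1) abK add_subgroupD(4)[OF assms(1)] by blast
    have grow: "?Y = A \<or> (card (insert K F) + 1) * card B \<le> card ?Y"
    proof (cases "X = A")
      case True
      have "card A = card ((+) (a K) ` X)" using True by (simp add: card_image)
      also have "\<dots> \<le> card ?Y" by (intro card_mono) auto
      finally have "?Y = A" using YA by (intro card_seteq) auto
      then show ?thesis ..
    next
      case False
      then have "card X + card B \<le> card ?Y"
        using card_add_two_translates[OF assms(1,2) maximal \<open>B \<subseteq> A\<close> X(1-3) abK] by blast
      then show ?thesis using False X(4) insert.hyps by simp
    qed
    have reach: "\<exists>\<phi>. y - (\<Sum>K'\<in>insert K F. if \<phi> K' then a K' else b K') \<in> B" if y: "y \<in> ?Y" for y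
    proof -
      obtain v x where v: "x \<in> X" "y = (if v then a K else b K) + x"
      proof -
        from y consider x where "x \<in> X" "y = a K + x" | x where "x \<in> X" "y = b K + x" by blast
        then show thesis by cases (use that[of _ True] that[of _ False] in auto)
      qed
      obtain \<phi> where \<phi>: "x - (\<Sum>K\<in>F. if \<phi> K then a K else b K) \<in> B" using X(5) v(1) by blast
      have "(\<Sum>K'\<in>F. if (\<phi>(K := v)) K' then a K' else b K') = (\<Sum>K\<in>F. if \<phi> K then a K else b K)"
        using insert.hyps by (intro sum.cong) auto
      then have "(\<Sum>K'\<in>insert K F. if (\<phi>(K := v)) K' then a K' else b K') =
          (if v then a K else b K) + (\<Sum>K\<in>F. if \<phi> K then a K else b K)"
        using insert.hyps by simp
      then have "y - (\<Sum>K'\<in>insert K F. if (\<phi>(K := v)) K' then a K' else b K') \<in> B"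
        using \<phi> v(2) by (simp only: add_diff_cancel_left)
      then show ?thesis by blast
    qed
    have "\<forall>x\<in>?Y. \<forall>d\<in>B. x + d \<in> ?Y" using X(3) by (auto simp: add.assoc)
    then show ?case using YA X(2) grow reach by (intro exI[of _ ?Y]) blast
  qed
  then obtain X where X: "X \<subseteq> A" "X = A \<or> (card F + 1) * card B \<le> card X"
    "\<forall>x\<in>X. \<exists>\<phi>. x - (\<Sum>K\<in>F. if \<phi> K then a K else b K) \<in> B" by blast
  have "X = A"
  proof (cases "X = A")
    case False
    then have "card A \<le> card X" using X(2) assms(6) by linarith
    then show ?thesis using X(1) by (intro card_seteq) auto
  qed
  then show ?thesis using X(3) \<open>x \<in> A\<close> that by blast
qed

text \<open>Applied to sets of size \<open>s + 1\<close>: a choice between two classes modulo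
  \<open>B\<close> for one vertex more than an edge.\<close>

definition mixed_set :: "('v set \<Rightarrow> 'g) \<Rightarrow> 'g :: ab_group_add set \<Rightarrow> nat \<Rightarrow> 'v set \<Rightarrow> bool" where
  "mixed_set c B s K \<longleftrightarrow>
    (\<exists>e e'. e \<subseteq> K \<and> e' \<subseteq> K \<and> card e = s \<and> card e' = s \<and> c e - c e' \<notin> B)"

text \<open>The extra edge \<open>e0\<close> supplies the missing edge of the \<open>[A : B]\<close>
  required; the choices in \<open>F\<close> are then made so that their sum is \<open>- c e0\<close>
  modulo \<open>B\<close>.\<close>

lemma mixed_matching_zero_sum:
  fixes A B :: "'g :: {ab_group_add, finite} set" and c :: "'v set \<Rightarrow> 'g"
  assumes "add_subgroup A" "add_subgroup B"
    and maximal: "\<forall>C. add_subgroup C \<longrightarrow> B \<subseteq> C \<longrightarrow> C \<subseteq> A \<longrightarrow> C = B \<or> C = A"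
    and "B \<subseteq> A" "card A = (card F + 1) * card B" "0 < s" "finite V"
    and c: "\<forall>e\<subseteq>V. card e = s \<longrightarrow> c e \<in> A"
    and F: "uniform_matching (Suc s) V F" "\<forall>K\<in>F. mixed_set c B s K"
    and "Suc s * card F + s \<le> card V"
  shows "\<exists>M. uniform_matching s V M \<and> card M = card F + 1 \<and> sum c M \<in> B"
proof -
  note mF = uniform_matchingD[OF F(1) \<open>finite V\<close>]
  have "s \<le> card (V - \<Union> F)"
    using mF assms(7) assms(11) by (simp add: card_Diff_subset finite_subset[OF mF(3)])
  then obtain e0 where e0: "e0 \<subseteq> V - \<Union> F" "card e0 = s" by (rule obtain_subset_with_card_n)
  obtain a b where ab: "\<And>K. K \<in> F \<Longrightarrow> a K \<subseteq> K \<and> b K \<subseteq> K \<and> card (a K) = s \<and> card (b K) = s \<and>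
      c (a K) - c (b K) \<notin> B"
    using F(2) unfolding mixed_set_def by metis
  have cA: "\<forall>K\<in>F. c (a K) \<in> A \<and> c (b K) \<in> A \<and> c (a K) - c (b K) \<notin> B"
  proof
    fix K assume K: "K \<in> F"
    then have "a K \<subseteq> V" "b K \<subseteq> V" using ab[OF K] mF(3) by blast+
    then show "c (a K) \<in> A \<and> c (b K) \<in> A \<and> c (a K) - c (b K) \<notin> B"
      using ab[OF K] c by simp
  qed
  have "- c e0 \<in> A" using c e0 add_subgroupD(3)[OF assms(1)] by blast
  moreover have "card A \<le> (card F + 1) * card B" using assms(5) by simp
  ultimately obtain \<phi> where
    \<phi>: "- c e0 - (\<Sum>K\<in>F. if \<phi> K then c (a K) else c (b K)) \<in> B"
    using choice_sums_cover[OF assms(1,2) maximal \<open>B \<subseteq> A\<close> mF(1) _ cA] by blast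
  define \<psi> where "\<psi> K = (if \<phi> K then a K else b K)" for K
  have \<psi>: "\<psi> K \<subseteq> K \<and> card (\<psi> K) = s" if "K \<in> F" for K using ab[OF that] by (simp add: \<psi>_def)
  note im = uniform_matching_image[OF F(1) \<psi> \<open>0 < s\<close>]
  have "uniform_matching s V (\<psi> ` F)" using uniform_matching_mono[OF im(1)] mF(3) by blast
  moreover have "e0 \<inter> \<Union> (\<psi> ` F) = {}" using e0(1) \<psi> by blast
  ultimately have M: "uniform_matching s V (insert e0 (\<psi> ` F))" "e0 \<notin> \<psi> ` F"
    using uniform_matching_insert[of s V "\<psi> ` F" e0] e0 \<open>0 < s\<close> by auto
  have "sum c (insert e0 (\<psi> ` F)) = c e0 + (\<Sum>K\<in>F. c (\<psi> K))"
    using M(2) mF(1) im(2) by (simp add: sum.reindex)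
  also have "(\<Sum>K\<in>F. c (\<psi> K)) = (\<Sum>K\<in>F. if \<phi> K then c (a K) else c (b K))"
    by (rule sum.cong) (auto simp: \<psi>_def)
  finally have "- sum c (insert e0 (\<psi> ` F)) \<in> B" using \<phi> by simp
  then have "sum c (insert e0 (\<psi> ` F)) \<in> B" using add_subgroupD(3)[OF assms(2)] by fastforce
  moreover have "card (insert e0 (\<psi> ` F)) = card F + 1"
    using M(2) mF(1) im(2) by (simp add: card_image)
  ultimately show ?thesis using M(1) by blast
qed

text \<open>The sum is congruent to the \<open>k\<close>-fold multiple of \<open>g\<close>, and
  \<open>k\<close> is the index of \<open>B\<close>.\<close>

lemma constant_matching_zero_sum:
  fixes A B :: "'g :: {ab_group_add, finite} set" and c :: "'v set \<Rightarrow> 'g"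
  assumes "add_subgroup A" "add_subgroup B" "B \<subseteq> A" "card A = k * card B" "g \<in> A"
    and "finite M" "card M = k" "\<And>e. e \<in> M \<Longrightarrow> c e - g \<in> B"
  shows "sum c M \<in> B"
proof -
  have "sum c M - (\<Sum>e\<in>M. g) \<in> B" using assms(8) by (intro add_subgroup_sum_diff[OF assms(2)])
  moreover have "(\<Sum>e\<in>M. g) \<in> B"
    using index_multiple_in_subgroup[OF assms(1-5)] sum_constant_multiple[OF assms(6), of g] assms(7)
    by simp
  ultimately have "(sum c M - (\<Sum>e\<in>M. g)) + (\<Sum>e\<in>M. g) \<in> B" by (rule add_subgroupD(4)[OF assms(2)])
  then show ?thesis by simp
qed

text \<open>A largest family of disjoint mixed sets either suffices for the previous lemma, or its
  complement is constant modulo \<open>B\<close>; in the second case each member can be exchanged for one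
  containing an edge of that constant class, so that it wastes only one vertex.\<close>

lemma matching_sum_in_maximal_subgroup:
  fixes A B :: "'g :: {ab_group_add, finite} set" and c :: "'v set \<Rightarrow> 'g"
  assumes "add_subgroup A" "add_subgroup B"
    and maximal: "\<forall>C. add_subgroup C \<longrightarrow> B \<subseteq> C \<longrightarrow> C \<subseteq> A \<longrightarrow> C = B \<or> C = A"
    and "B \<subseteq> A" "card A = k * card B" "0 < s" "finite V" "s * k + k \<le> card V + 1"
    and c: "\<forall>e\<subseteq>V. card e = s \<longrightarrow> c e \<in> A"
  shows "\<exists>M. uniform_matching s V M \<and> card M = k \<and> sum c M \<in> B"
proof -
  have "0 < k" using card_subgroup_pos[OF assms(1)] assms(5) by (cases k) auto
  define fam where
    "fam F \<longleftrightarrow> uniform_matching (Suc s) V F \<and> (\<forall>K\<in>F. mixed_set c B s K)" for F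
  show ?thesis
  proof (cases "\<exists>F. fam F \<and> k - 1 \<le> card F")
    case True
    then obtain F' where F': "fam F'" "k - 1 \<le> card F'" by blast
    then obtain F where F: "F \<subseteq> F'" "card F = k - 1" by (meson obtain_subset_with_card_n)
    have Fk: "card F + 1 = k" using F(2) \<open>0 < k\<close> by simp
    have size: "Suc s * card F + s \<le> card V"
    proof -
      have "s * k + k = Suc s * card F + s + 1" unfolding Fk[symmetric] by (simp add: algebra_simps)
      then show ?thesis using assms(8) by linarith
    qed
    have "card A = (card F + 1) * card B" using Fk assms(5) by simp
    moreover have "uniform_matching (Suc s) V F" using F'(1) F(1) uniform_matching_mono fam_def by blast
    moreover have "\<forall>K\<in>F. mixed_set c B s K" using F(1) F'(1) by (auto simp: fam_def)
    ultimately show ?thesis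
      using mixed_matching_zero_sum[OF assms(1,2) maximal \<open>B \<subseteq> A\<close> _ assms(6,7) c _ _ size] Fk
      by simp
  next
    case False
    then have few: "card F + 2 \<le> k" if "fam F" for F using that \<open>0 < k\<close> by force
    define rest where "rest F = V - \<Union> F" for F
    have rest_card: "card (rest F) + Suc s * card F = card V" if "fam F" for F
    proof -
      note m = uniform_matchingD[OF conjunct1[OF that[unfolded fam_def]] \<open>finite V\<close>]
      have "card (\<Union> F) \<le> card V" using m(3) assms(7) card_mono by blast
      then show ?thesis
        using m(2,3) assms(7) by (simp add: rest_def card_Diff_subset finite_subset[OF m(3)])
    qed
    \<comment> \<open>\<open>(s * k + k - 1) - (s + 1) * (k - 2) = 2 * s + 1\<close>. An exchange
      below needs room for an edge \<open>S\<close> and a second edge \<open>e1\<close> disjoint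
      from it.\<close>
    have rest_big: "2 * s + 1 \<le> card (rest F)" if fF: "fam F" for F
    proof -
      obtain j where j: "k = card F + 2 + j" using few[OF fF] le_Suc_ex by blast
      have "s * k + k = Suc s * card F + 2 * s + 2 + s * j + j"
        unfolding j by (simp add: algebra_simps)
      then show ?thesis using rest_card[OF fF] assms(8) by linarith
    qed
    define maxfam where "maxfam F \<longleftrightarrow> fam F \<and> (\<forall>F'. fam F' \<longrightarrow> card F' \<le> card F)" for F
    \<comment> \<open>Two classes in the complement would give adjacent edges of different classes,
      whose union is one more mixed set, against maximality.\<close>
    have rest_constant: "c e - c e0 \<in> B"
      if F: "maxfam F" and e: "e \<subseteq> rest F" "card e = s" and e0: "e0 \<subseteq> rest F" "card e0 = s"
      for F e e0
    proof (rule ccontr)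
      assume neg: "c e - c e0 \<notin> B"
      have fin: "finite e" "finite e0"
        using e(1) e0(1) assms(7) unfolding rest_def by (meson finite_Diff finite_subset)+
      obtain f f' where f: "f \<subseteq> e \<union> e0" "f' \<subseteq> e \<union> e0" "card f = s" "card f' = s"
        "card (f \<union> f') = Suc s" "c f - c e0 \<notin> B" "c f' - c e0 \<in> B"
        using ex_adjacent_sets[of e s "\<lambda>f. c f - c e0 \<in> B" e0] fin e(2) e0(2) neg
          add_subgroupD(1)[OF assms(2)] by auto
      have "c f - c f' \<notin> B" using add_subgroupD(4)[OF assms(2), of "c f - c f'" "c f' - c e0"] f(6,7) by auto
      then have mixed: "mixed_set c B s (f \<union> f')" using f(3,4) unfolding mixed_set_def by blast
      have sub: "f \<union> f' \<subseteq> rest F" using f(1,2) e(1) e0(1) by blast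
      have mF: "uniform_matching (Suc s) V F" using F by (simp add: maxfam_def fam_def)
      have "f \<union> f' \<subseteq> V" "(f \<union> f') \<inter> \<Union> F = {}" using sub by (auto simp: rest_def)
      then have "uniform_matching (Suc s) V (insert (f \<union> f') F)" "f \<union> f' \<notin> F"
        using uniform_matching_insert[OF mF] f(5) by blast+
      moreover from this(1) have "fam (insert (f \<union> f') F)"
        using mixed F by (simp add: fam_def maxfam_def)
      ultimately show False
        using F uniform_matchingD(1)[OF mF assms(7)] unfolding maxfam_def by fastforce
    qed
    have "fam {}" by (simp add: fam_def uniform_matching_def)
    moreover have "\<forall>F. fam F \<longrightarrow> card F < k" using few by force
    ultimately obtain F0 where F0: "maxfam F0"
      unfolding maxfam_def using ex_has_greatest_nat[of fam "{}" card k] by blast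
    have "s \<le> card (rest F0)" using rest_big[of F0] F0 by (simp add: maxfam_def)
    then obtain e0 where e0: "e0 \<subseteq> rest F0" "card e0 = s" by (rule obtain_subset_with_card_n)
    define g where "g = c e0"
    have gA: "g \<in> A" using e0 c by (auto simp: g_def rest_def)
    \<comment> \<open>The class of the complement is pinned to \<open>g\<close>, so that
      \<open>good\<close> counts with respect to the same class throughout the exchanges.\<close>
    define P where "P F \<longleftrightarrow> maxfam F \<and> (\<forall>e\<subseteq>rest F. card e = s \<longrightarrow> c e - g \<in> B)" for F
    define good where "good F = {K \<in> F. \<exists>e\<subseteq>K. card e = s \<and> c e - g \<in> B}" for F
    have "P F0" using F0 rest_constant e0 by (simp add: P_def g_def)
    moreover have "card (good F) < k" if "P F" for F
    proof -
      have fF: "fam F" using that by (simp add: P_def maxfam_def)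
      then have "finite F" using uniform_matchingD(1)[OF _ assms(7)] by (auto simp: fam_def)
      then have "card (good F) \<le> card F" by (intro card_mono) (auto simp: good_def)
      then show ?thesis using few[OF fF] by linarith
    qed
    ultimately obtain F where F: "P F" "\<And>F'. P F' \<Longrightarrow> card (good F') \<le> card (good F)"
      using ex_has_greatest_nat[of P F0 "\<lambda>F. card (good F)" k] by blast
    have mF: "uniform_matching (Suc s) V F" and fF: "fam F"
      using F(1) by (auto simp: P_def maxfam_def fam_def)
    note mF' = uniform_matchingD[OF mF assms(7)]
    have "\<exists>e\<subseteq>K. card e = s \<and> c e - g \<in> B" if K: "K \<in> F" for K
    proof (rule ccontr)
      assume bad: "\<not> (\<exists>e\<subseteq>K. card e = s \<and> c e - g \<in> B)"
      have KV: "K \<subseteq> V" "card K = Suc s" using mF K by (auto simp: uniform_matching_def)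
      then obtain e where e: "e \<subseteq> K" "card e = s" "finite e"
        using obtain_subset_with_card_n[of s K] by auto
      have "s \<le> card (rest F)" using rest_big[OF fF] by linarith
      then obtain S where S: "S \<subseteq> rest F" "card S = s" "finite S" by (rule obtain_subset_with_card_n)
      \<comment> \<open>No edge inside \<open>K\<close> has class \<open>g\<close>, while
        \<open>S\<close> does. The switch between them yields a mixed set \<open>K'\<close> inside
        \<open>K \<union> S\<close> containing the edge \<open>f'\<close> of class \<open>g\<close>;
        replacing \<open>K\<close> by it raises the count of \<open>good\<close>.\<close>
      obtain f f' where f: "f \<subseteq> e \<union> S" "f' \<subseteq> e \<union> S" "card f = s" "card f' = s"
        "card (f \<union> f') = Suc s" "c f - g \<notin> B" "c f' - g \<in> B"
        using ex_adjacent_sets[of e s "\<lambda>f. c f - g \<in> B" S] e S bad F(1) by (auto simp: P_def)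
      define K' where "K' = f \<union> f'"
      define F' where "F' = insert K' (F - {K})"
      have "c f - c f' \<notin> B" using add_subgroupD(4)[OF assms(2), of "c f - c f'" "c f' - g"] f(6,7) by auto
      then have mixed: "mixed_set c B s K'" using f(3,4) unfolding mixed_set_def K'_def by blast
      have K'sub: "K' \<subseteq> K \<union> S" using f(1,2) e(1) by (auto simp: K'_def)
      have "K \<inter> \<Union> (F - {K}) = {}"
        using mF K by (auto simp: uniform_matching_def pairwise_def disjnt_def)
      then have "K' \<inter> \<Union> (F - {K}) = {}" using K'sub S(1) unfolding rest_def by blast
      moreover have "uniform_matching (Suc s) V (F - {K})" using uniform_matching_mono[OF mF] by blast
      moreover have "K' \<subseteq> V" using K'sub KV(1) S(1) by (auto simp: rest_def)
      ultimately have mF'': "uniform_matching (Suc s) V F'" and K'new: "K' \<notin> F - {K}"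
        using uniform_matching_insert[of "Suc s" V "F - {K}" K'] f(5) by (auto simp: F'_def K'_def)
      have "card F' = card F"
        using K'new mF'(1) K card_Suc_Diff1[of F K] by (simp add: F'_def)
      moreover have "fam F'" using mF'' mixed fF by (auto simp: fam_def F'_def)
      ultimately have maxF': "maxfam F'" using F(1) by (simp add: P_def maxfam_def)
      have "P F'"
      proof -
        have "s \<le> card (rest F - S)"
          using rest_big[OF fF] S by (simp add: card_Diff_subset)
        \<comment> \<open>This edge lies in the complement both before and after the exchange, so
          the class \<open>g\<close> carries over.\<close>
        then obtain e1 where e1: "e1 \<subseteq> rest F - S" "card e1 = s" by (rule obtain_subset_with_card_n)
        have e1': "e1 \<subseteq> rest F'" using e1(1) K'sub K by (auto simp: rest_def F'_def)
        have "c e1 - g \<in> B" using e1 F(1) by (auto simp: P_def)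
        then have "c e' - g \<in> B" if "e' \<subseteq> rest F'" "card e' = s" for e'
          using add_subgroupD(4)[OF assms(2), of "c e' - c e1" "c e1 - g"]
            rest_constant[OF maxF' that e1' e1(2)] by simp
        then show ?thesis using maxF' by (simp add: P_def)
      qed
      then have "card (good F') \<le> card (good F)" by (rule F(2))
      moreover have "K \<notin> good F" using bad by (auto simp: good_def)
      then have "insert K' (good F) \<subseteq> good F'" "K' \<notin> good F"
        using K'new f(4,7) by (auto simp: good_def F'_def K'_def)
      then have "card (insert K' (good F)) \<le> card (good F')"
        using mF'(1) by (intro card_mono) (auto simp: good_def F'_def)
      then have "Suc (card (good F)) \<le> card (good F')"
        using \<open>K' \<notin> good F\<close> mF'(1) by (simp add: good_def)
      ultimately show False by simp
    qed
    then obtain \<phi> where \<phi>: "\<And>K. K \<in> F \<Longrightarrow> \<phi> K \<subseteq> K \<and> card (\<phi> K) = s \<and> c (\<phi> K) - g \<in> B" by metis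
    then have \<phi>': "\<phi> K \<subseteq> K \<and> card (\<phi> K) = s" if "K \<in> F" for K using that by blast
    note im = uniform_matching_image[OF mF \<phi>' \<open>0 < s\<close>]
    have finr: "finite (rest F)" using assms(7) by (simp add: rest_def)
    \<comment> \<open>Each member of \<open>F\<close> wastes one vertex, and
      \<open>card F < k\<close> keeps the waste within the surplus \<open>k - 1\<close>.\<close>
    have "s * (k - card F) \<le> card (rest F)"
    proof -
      obtain j where j: "k = card F + j" using few[OF fF] le_Suc_ex[of "card F" k] by auto
      have "s * k + k = Suc s * card F + s * j + j" unfolding j by (simp add: algebra_simps)
      moreover have "0 < j" using few[OF fF] j by simp
      ultimately have "s * j \<le> card (rest F)" using rest_card[OF fF] assms(8) by linarith
      then show ?thesis using j by simp
    qed
    then obtain N where N: "uniform_matching s (rest F) N" "card N = k - card F"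
      using ex_uniform_matching[OF finr \<open>0 < s\<close>] by blast
    have "\<Union> F \<inter> rest F = {}" by (auto simp: rest_def)
    note un = uniform_matching_Un[OF im(1) N(1) this \<open>0 < s\<close>]
    have finN: "finite N" by (rule uniform_matchingD(1)[OF N(1) finr])
    have "uniform_matching s V (\<phi> ` F \<union> N)"
      using uniform_matching_mono[OF un(1)] mF'(3) by (auto simp: rest_def)
    moreover have card: "card (\<phi> ` F \<union> N) = k"
      using un(2) mF'(1) finN im(2) N(2) few[OF fF] by (simp add: card_Un_disjoint card_image)
    moreover have "sum c (\<phi> ` F \<union> N) \<in> B"
    proof (rule constant_matching_zero_sum[OF assms(1,2,4,5) gA _ card])
      show "c e - g \<in> B" if "e \<in> \<phi> ` F \<union> N" for e
        using that \<phi> F(1) N(1) by (auto simp: P_def uniform_matching_def)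
    qed (use mF'(1) finN in simp)
    ultimately show ?thesis by blast
  qed
qed

text \<open>For a chain \<open>B \<subset> C \<subset> A\<close> with indices \<open>a = [A : C]\<close> and \<open>b = [C : B]\<close>, every set of
  \<open>t = s * a + a - 1\<close> vertices contains \<open>a\<close> disjoint edges with sum in \<open>C\<close>. Colouring the \<open>t\<close>-sets by
  these sums reduces to \<open>C\<close> and \<open>B\<close>, and the vertex counts match:
  \<open>t * b + b - 1 = s * (a * b) + a * b - 1\<close>.\<close>

lemma matching_sum_in_subgroup:
  fixes A B :: "'g :: {ab_group_add, finite} set" and c :: "'v set \<Rightarrow> 'g"
  assumes "add_subgroup A" "add_subgroup B" "B \<subseteq> A" "card A = k * card B"
    and "0 < s" "finite V" "s * k + k \<le> card V + 1"
    and "\<forall>e\<subseteq>V. card e = s \<longrightarrow> c e \<in> A"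
  shows "\<exists>M. uniform_matching s V M \<and> card M = k \<and> sum c M \<in> B"
  using assms
proof (induction "card A - card B" arbitrary: A B k s V c rule: less_induct)
  case less
  note sub = less.prems(1,2) and BA = less.prems(3)
  show ?case
  proof (cases "\<exists>C. add_subgroup C \<and> B \<subset> C \<and> C \<subset> A")
    case False
    show ?thesis
      \<comment> \<open>This covers \<open>B = A\<close> as well, where the index is 1.\<close>
      by (rule matching_sum_in_maximal_subgroup[OF sub _ BA less.prems(4-7)])
        (use False less.prems(8) in blast)+
  next
    case True
    then obtain C where C: "add_subgroup C" "B \<subset> C" "C \<subset> A" by blast
    obtain a where a: "card A = a * card C" using subgroup_index[OF sub(1) C(1)] C(3) by blast
    obtain b where b: "card C = b * card B" using subgroup_index[OF C(1) sub(2)] C(2) by blast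
    \<comment> \<open>The measure drops for both pairs, \<open>A\<close> over \<open>C\<close> and
      \<open>C\<close> over \<open>B\<close>.\<close>
    have lt: "card B < card C" "card C < card A" using C(2,3) by (simp_all add: psubset_card_mono)
    have k: "k = a * b" using a b less.prems(4) card_subgroup_pos[OF sub(2)] by auto
    have "0 < a" using a lt by (cases a) auto
    define t where "t = s * a + a - 1"
    have t: "t + 1 = s * a + a" using \<open>0 < a\<close> by (simp add: t_def)
    have "0 < t" using t \<open>0 < a\<close> less.prems(5) by (cases a) auto
    have "\<exists>M. uniform_matching s S M \<and> card M = a \<and> sum c M \<in> C" if S: "S \<subseteq> V" "card S = t" for S
    proof (rule less.hyps[OF _ sub(1) C(1) _ a less.prems(5)])
      show "finite S" using S(1) less.prems(6) finite_subset by blast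
    qed (use lt C S t less.prems(8) in auto)
    then obtain \<mu> where
      \<mu>: "\<And>S. S \<subseteq> V \<Longrightarrow> card S = t \<Longrightarrow> uniform_matching s S (\<mu> S) \<and> card (\<mu> S) = a \<and> sum c (\<mu> S) \<in> C"
      by metis
    have "\<exists>N. uniform_matching t V N \<and> card N = b \<and> sum (\<lambda>S. sum c (\<mu> S)) N \<in> B"
    proof (rule less.hyps[OF _ C(1) sub(2) _ b \<open>0 < t\<close> less.prems(6)])
      have "t * b + b = s * k + k" using arg_cong[OF t, of "\<lambda>x. x * b"] by (simp add: k algebra_simps)
      then show "t * b + b \<le> card V + 1" using less.prems(7) by simp
    qed (use lt C \<mu> in auto)
    then obtain N where N: "uniform_matching t V N" "card N = b" "sum (\<lambda>S. sum c (\<mu> S)) N \<in> B" by blast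
    have \<mu>N: "uniform_matching s S (\<mu> S)" "card (\<mu> S) = a" "finite (\<mu> S)" if "S \<in> N" for S
    proof -
      have S: "S \<subseteq> V" "card S = t" using N(1) that by (auto simp: uniform_matching_def)
      show m: "uniform_matching s S (\<mu> S)" and "card (\<mu> S) = a" using \<mu>[OF S] by auto
      show "finite (\<mu> S)" using uniform_matchingD(1)[OF m] S(1) less.prems(6) finite_subset by blast
    qed
    have disj: "S \<inter> S' = {}" if "S \<in> N" "S' \<in> N" "S \<noteq> S'" for S S'
      using N(1) that by (auto simp: uniform_matching_def pairwise_def disjnt_def)
    have \<mu>_disj: "\<mu> S \<inter> \<mu> S' = {}" if "S \<in> N" "S' \<in> N" "S \<noteq> S'" for S S'
      using uniform_matching_Un(2)[OF \<mu>N(1)[OF that(1)] \<mu>N(1)[OF that(2)] disj[OF that] less.prems(5)] .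
    have finN: "finite N" by (rule uniform_matchingD(1)[OF N(1) less.prems(6)])
    let ?M = "\<Union> (\<mu> ` N)"
    have "uniform_matching s V ?M"
    proof -
      have "disjnt e e'" if e: "e \<in> ?M" "e' \<in> ?M" "e \<noteq> e'" for e e'
      proof -
        obtain S S' where S: "S \<in> N" "S' \<in> N" "e \<in> \<mu> S" "e' \<in> \<mu> S'" using e(1,2) by blast
        show ?thesis
        proof (cases "S = S'")
          case True
          then show ?thesis
            using \<mu>N(1)[OF S(1)] S e(3) by (auto simp: uniform_matching_def pairwise_def)
        next
          case False
          have "e \<subseteq> S" "e' \<subseteq> S'" using \<mu>N(1) S by (auto simp: uniform_matching_def)
          then show ?thesis using disj[OF S(1,2) False] by (auto simp: disjnt_def)
        qed
      qed
      moreover have "e \<subseteq> V \<and> card e = s" if "e \<in> ?M" for e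
        using that \<mu>N(1) N(1) unfolding uniform_matching_def by blast
      ultimately show ?thesis unfolding uniform_matching_def pairwise_def by blast
    qed
    moreover have "card ?M = k"
    proof -
      have "card ?M = (\<Sum>S\<in>N. card (\<mu> S))"
        using finN \<mu>N(3) \<mu>_disj by (intro card_UN_disjoint) auto
      also have "\<dots> = k" using \<mu>N(2) N(2) by (simp add: k)
      finally show ?thesis .
    qed
    moreover have "sum c ?M = (\<Sum>S\<in>N. sum c (\<mu> S))"
      using finN \<mu>N(3) \<mu>_disj by (intro sum.UNION_disjoint) auto
    ultimately show ?thesis using N(3) by auto
  qed
qed

text \<open>The exponent \<open>e\<close> divides both \<open>m\<close> and \<open>n = |G|\<close>,
  so \<open>m > n\<close> means \<open>m >= n + e\<close>. Hence \<open>n + e\<close> disjoint edges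
  fit, and after a zero-sum set of \<open>e\<close> of them is removed, at least \<open>n\<close>
  edges are still to be found, with the surplus of \<open>n - 1\<close> vertices intact.\<close>

lemma zero_sum_matching:
  fixes c :: "'v set \<Rightarrow> 'g :: {ab_group_add, finite}"
  assumes "0 < s" "finite V" "card (UNIV :: 'g set) \<le> m" "group_exponent TYPE('g) dvd m"
    and "s * m + (card (UNIV :: 'g set) - 1) \<le> card V"
  shows "\<exists>M. uniform_matching s V M \<and> card M = m \<and> sum c M = 0"
  using assms(2-5)
proof (induction m arbitrary: V rule: less_induct)
  case (less m)
  let ?n = "card (UNIV :: 'g set)" and ?e = "group_exponent TYPE('g)"
  have "0 < ?n" by (simp add: finite_UNIV_card_ge_0)
  show ?case
  proof (cases "m = ?n")
    case True
    have "\<exists>M. uniform_matching s V M \<and> card M = m \<and> sum c M \<in> {0}"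
      by (rule matching_sum_in_subgroup[where A = UNIV])
        (use True less.prems assms(1) \<open>0 < ?n\<close> in \<open>auto simp: add_subgroup_def\<close>)
    then show ?thesis by simp
  next
    case False
    have "?e dvd m - ?n" using less.prems(3) group_exponent_dvd_card by (rule dvd_diff_nat)
    then have "?n + ?e \<le> m" using False less.prems(2) by (auto dest: dvd_imp_le)
    then have "s * (?n + ?e) \<le> s * m" by (rule mult_le_mono2)
    then have "s * (?n + ?e) \<le> card V" using less.prems(4) by linarith
    then obtain N where N: "uniform_matching s V N" "card N = ?n + ?e"
      using ex_uniform_matching[OF less.prems(1) assms(1)] by blast
    obtain J where J: "J \<subseteq> N" "card J = ?e" "sum c J = 0"
      using zero_sum_of_exponent_length[of N c] uniform_matchingD(1)[OF N(1) less.prems(1)] N(2) by auto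
    have mJ: "uniform_matching s V J" using uniform_matching_mono[OF N(1) J(1)] by blast
    note mJ' = uniform_matchingD[OF mJ less.prems(1)]
    let ?V = "V - \<Union> J"
    have epos: "0 < ?e" by (rule group_exponent_multiple(1))
    obtain j where j: "m = ?e + j" using \<open>?n + ?e \<le> m\<close> le_Suc_ex[of ?e m] by auto
    have "card ?V = card V - s * ?e"
      using mJ'(2,3) J(2) less.prems(1) by (simp add: card_Diff_subset finite_subset[OF mJ'(3)])
    then have "s * j + (?n - 1) \<le> card ?V" using less.prems(4) by (simp add: j algebra_simps)
    moreover have "?e dvd j" using less.prems(3) by (simp add: j)
    moreover have "j < m" "?n \<le> j" using j epos \<open>?n + ?e \<le> m\<close> by auto
    ultimately obtain M where M: "uniform_matching s ?V M" "card M = j" "sum c M = 0"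
      using less.IH[of j ?V] less.prems(1) by auto
    have mJU: "uniform_matching s (\<Union> J) J" using mJ by (auto simp: uniform_matching_def)
    have "\<Union> J \<inter> ?V = {}" by blast
    note un = uniform_matching_Un[OF mJU M(1) this assms(1)]
    have "finite M" using uniform_matchingD(1)[OF M(1)] less.prems(1) by simp
    then have "card (J \<union> M) = m" "sum c (J \<union> M) = 0"
      using un(2) mJ'(1) J M by (auto simp: card_Un_disjoint sum.union_disjoint j)
    moreover have "uniform_matching s V (J \<union> M)"
      using uniform_matching_mono[OF un(1)] mJ'(3) by blast
    ultimately show ?thesis by blast
  qed
qed

section \<open>Delta-systems\<close>

text \<open>Supplies a core contained in every edge, including the degenerate case of a single
  edge.\<close>

lemma delta_system_petals:
  assumes "delta_system r q m e" "0 < m"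
  obtains Q where "finite Q" "card Q = q" "\<And>i. i \<in> {1..m} \<Longrightarrow> Q \<subseteq> e i"
    "\<And>i. i \<in> {1..m} \<Longrightarrow> card (e i - Q) = r - q"
    "\<And>i j. i \<in> {1..m} \<Longrightarrow> j \<in> {1..m} \<Longrightarrow> i \<noteq> j \<Longrightarrow> (e i - Q) \<inter> (e j - Q) = {}"
proof -
  note d = assms(1)[unfolded delta_system_def]
  have er: "finite (e i)" "card (e i) = r" if "i \<in> {1..m}" for i using d that by auto
  have "\<exists>Q. finite Q \<and> card Q = q \<and> (\<forall>i\<in>{1..m}. Q \<subseteq> e i) \<and>
      (\<forall>i\<in>{1..m}. \<forall>j\<in>{1..m}. i \<noteq> j \<longrightarrow> (e i - Q) \<inter> (e j - Q) = {})"
  proof (cases "m = 1")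
    \<comment> \<open>With one edge the intersection condition is vacuous and the given core may lie
      anywhere, so a core is chosen inside \<open>e 1\<close>.\<close>
    case True
    then obtain Q where "Q \<subseteq> e 1" "card Q = q" "finite Q"
      using obtain_subset_with_card_n[of q "e 1"] er[of 1] d by auto
    then show ?thesis using True by auto
  next
    case False
    obtain Q where Q: "finite Q" "card Q = q" "\<And>i j. 1 \<le> i \<Longrightarrow> i < j \<Longrightarrow> j \<le> m \<Longrightarrow> e i \<inter> e j = Q"
      using d by blast
    have Qij: "e i \<inter> e j = Q" if "i \<in> {1..m}" "j \<in> {1..m}" "i \<noteq> j" for i j
      using Q(3)[of i j] Q(3)[of j i] that by (cases "i < j") (auto simp: Int_commute)
    have "Q \<subseteq> e i" if "i \<in> {1..m}" for i
    proof -
      have "(if i = 1 then 2 else 1) \<in> {1..m}" "i \<noteq> (if i = 1 then 2 else 1)"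
        using False assms(2) by auto
      then show ?thesis using Qij[OF that] by blast
    qed
    then show ?thesis using Q(1,2) Qij by (intro exI[of _ Q]) blast
  qed
  then obtain Q where Q: "finite Q" "card Q = q" "\<forall>i\<in>{1..m}. Q \<subseteq> e i"
    "\<forall>i\<in>{1..m}. \<forall>j\<in>{1..m}. i \<noteq> j \<longrightarrow> (e i - Q) \<inter> (e j - Q) = {}" by (elim exE conjE)
  show ?thesis
  proof (rule that[of Q])
    show "card (e i - Q) = r - q" if "i \<in> {1..m}" for i
      using Q(1-3) er[OF that] that by (simp add: card_Diff_subset)
  qed (use Q in simp_all)
qed

lemma delta_system_of_matching:
  assumes M: "uniform_matching (r - q) {q..<d} M" "card M = m" and "q < r" "q \<le> d"
    and c: "(\<Sum>f\<in>M. c ({..<q} \<union> f)) = 0"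
  shows "\<exists>e. delta_system r q m e \<and> (\<forall>i\<in>{1..m}. e i \<in> complete_edges r d) \<and> (\<Sum>i=1..m. c (e i)) = 0"
proof -
  have fin: "finite M" by (rule uniform_matchingD(1)[OF M(1)]) simp
  obtain \<beta> where \<beta>: "bij_betw \<beta> {1..m} M" using ex_bij_betw_nat_finite_1[OF fin] M(2) by blast
  define e where "e i = {..<q} \<union> \<beta> i" for i
  have \<beta>M: "\<beta> i \<in> M" "\<beta> i \<subseteq> {q..<d}" "card (\<beta> i) = r - q" "finite (\<beta> i)" if "i \<in> {1..m}" for i
  proof -
    show "\<beta> i \<in> M" using \<beta> that by (auto simp: bij_betw_def)
    then show "\<beta> i \<subseteq> {q..<d}" "card (\<beta> i) = r - q" using M(1) by (auto simp: uniform_matching_def)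
    then show "finite (\<beta> i)" by (meson finite_atLeastLessThan finite_subset)
  qed
  have disj: "\<beta> i \<inter> \<beta> j = {}" if "i \<in> {1..m}" "j \<in> {1..m}" "i \<noteq> j" for i j
  proof -
    have "\<beta> i \<noteq> \<beta> j" using inj_onD[OF bij_betw_imp_inj_on[OF \<beta>]] that by blast
    then show ?thesis
      using M(1) \<beta>M(1) that by (auto simp: uniform_matching_def pairwise_def disjnt_def)
  qed
  have card_e: "card (e i) = r" "finite (e i)" if "i \<in> {1..m}" for i
  proof -
    have "{..<q} \<inter> \<beta> i = {}" using \<beta>M(2)[OF that] by auto
    then show "card (e i) = r" "finite (e i)"
      using \<beta>M(3,4)[OF that] \<open>q < r\<close> by (simp_all add: e_def card_Un_disjoint)
  qed
  have int: "e i \<inter> e j = {..<q}" if "i \<in> {1..m}" "j \<in> {1..m}" "i \<noteq> j" for i j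
    using disj[OF that] by (auto simp: e_def)
  have "inj_on e {1..m}"
  proof (rule inj_onI, rule ccontr)
    fix i j assume ij: "i \<in> {1..m}" "j \<in> {1..m}" "e i = e j" "i \<noteq> j"
    then have "e i = {..<q}" using int[OF ij(1,2,4)] by simp
    then show False using card_e(1)[OF ij(1)] \<open>q < r\<close> by simp
  qed
  moreover have "\<forall>i j. 1 \<le> i \<and> i < j \<and> j \<le> m \<longrightarrow> e i \<inter> e j = {..<q}" using int by simp
  ultimately have "delta_system r q m e"
    unfolding delta_system_def using \<open>q < r\<close> card_e by (auto intro!: exI[of _ "{..<q}"])
  moreover have "e i \<in> complete_edges r d" if "i \<in> {1..m}" for i
    using \<beta>M(2)[OF that] card_e(1)[OF that] \<open>q \<le> d\<close> by (auto simp: complete_edges_def e_def)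
  moreover have "(\<Sum>i=1..m. c (e i)) = 0"
    using sum.reindex_bij_betw[OF \<beta>, of "\<lambda>f. c ({..<q} \<union> f)"] c by (simp add: e_def)
  ultimately show ?thesis by blast
qed

section \<open>Upper bounds\<close>

lemma delta_ramsey_le:
  assumes "q < r" "q < d"
    and "\<And>c :: nat set \<Rightarrow> 'g :: {ab_group_add, finite}.
      \<exists>M. uniform_matching (r - q) {q..<d} M \<and> card M = m \<and> sum c M = 0"
  shows "delta_ramsey r q m TYPE('g) \<le> d"
  unfolding delta_ramsey_def
proof (rule Least_le, intro conjI allI)
  show "0 < d" using assms(2) by simp
  fix c :: "nat set \<Rightarrow> 'g"
  show "\<exists>e. delta_system r q m e \<and> (\<forall>i\<in>{1..m}. e i \<in> complete_edges r d) \<and> (\<Sum>i=1..m. c (e i)) = 0"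
    using assms(3)[of "\<lambda>f. c ({..<q} \<union> f)"] delta_system_of_matching[of r q d _ m c] assms(1,2)
    by auto
qed

lemma delta_ramsey_upper_card:
  assumes "q < r" "card (UNIV :: 'g :: {ab_group_add, finite} set) \<le> m"
    and "group_exponent TYPE('g) dvd m"
  shows "delta_ramsey r q m TYPE('g) \<le> (r - q) * m + (card (UNIV :: 'g set) - 1) + q"
proof -
  have "0 < card (UNIV :: 'g set)" by (simp add: finite_UNIV_card_ge_0)
  then have "0 < (r - q) * m" using assms(1,2) by simp
  show ?thesis
  proof (rule delta_ramsey_le[OF assms(1)])
    fix c :: "nat set \<Rightarrow> 'g"
    show "\<exists>M. uniform_matching (r - q) {q..<(r - q) * m + (card (UNIV :: 'g set) - 1) + q} M \<and>
        card M = m \<and> sum c M = 0"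
      using assms by (intro zero_sum_matching) auto
  qed (use \<open>0 < (r - q) * m\<close> in simp)
qed

lemma delta_ramsey_upper_davenport:
  assumes "q < r" "card (UNIV :: 'g :: {ab_group_add, finite} set) \<le> m"
    and "group_exponent TYPE('g) dvd m"
  shows "delta_ramsey r q m TYPE('g) \<le> (r - q) * m + (r - q) * (davenport TYPE('g) - 1) + q"
proof -
  let ?D = "davenport TYPE('g)"
  let ?d = "(r - q) * m + (r - q) * (?D - 1) + q"
  have "0 < card (UNIV :: 'g set)" by (simp add: finite_UNIV_card_ge_0)
  then have "0 < (r - q) * m" using assms(1,2) by simp
  show ?thesis
  proof (rule delta_ramsey_le[OF assms(1)])
    fix c :: "nat set \<Rightarrow> 'g"
    have "(r - q) * (m + (?D - 1)) \<le> card {q..<?d}" by (simp add: algebra_simps)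
    then obtain N where N: "uniform_matching (r - q) {q..<?d} N" "card N = m + (?D - 1)"
      using ex_uniform_matching[of "{q..<?d}" "r - q" "m + (?D - 1)"] assms(1) by auto
    have "finite N" by (rule uniform_matchingD(1)[OF N(1)]) simp
    moreover have "m + ?D - 1 \<le> card N" using N(2) by linarith
    ultimately obtain M where M: "M \<subseteq> N" "card M = m" "sum c M = 0"
      using gao_zero_sum[of N m c] assms(2,3) by blast
    then show "\<exists>M. uniform_matching (r - q) {q..<?d} M \<and> card M = m \<and> sum c M = 0"
      using uniform_matching_mono[OF N(1) M(1)] by blast
  qed (use \<open>0 < (r - q) * m\<close> in simp)
qed

section \<open>Lower bounds\<close>

lemma delta_ramsey_property:
  assumes "q < r" "group_exponent TYPE('g :: {ab_group_add, finite}) dvd m"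
  obtains e where "delta_system r q m e"
    "\<And>i. i \<in> {1..m} \<Longrightarrow> e i \<subseteq> {..<delta_ramsey r q m TYPE('g)}"
    "(\<Sum>i=1..m. c (e i) :: 'g) = 0"
proof -
  let ?d = "delta_ramsey r q m TYPE('g)"
  have "\<forall>c :: nat set \<Rightarrow> 'g. \<exists>e. delta_system r q m e \<and>
      (\<forall>i\<in>{1..m}. e i \<in> complete_edges r ?d) \<and> (\<Sum>i=1..m. c (e i)) = 0"
    unfolding delta_ramsey_def by (rule conjunct2[OF LeastI_ex[OF delta_ramsey_exists[OF assms]]])
  then obtain e where "delta_system r q m e" "\<forall>i\<in>{1..m}. e i \<in> complete_edges r ?d"
    "(\<Sum>i=1..m. c (e i)) = 0"
    by meson
  then show ?thesis using that[of e] by (simp add: complete_edges_def)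
qed

text \<open>A count of vertices: the core and \<open>m\<close> disjoint petals. Any colouring, here
  0, produces the delta-system.\<close>

lemma delta_ramsey_lower_core:
  assumes "q < r" "0 < m" "group_exponent TYPE('g :: {ab_group_add, finite}) dvd m"
  shows "(r - q) * m + q \<le> delta_ramsey r q m TYPE('g)"
proof -
  let ?d = "delta_ramsey r q m TYPE('g)"
  obtain e where e: "delta_system r q m e" "\<And>i. i \<in> {1..m} \<Longrightarrow> e i \<subseteq> {..<?d}"
    using delta_ramsey_property[OF assms(1,3), of "\<lambda>_. 0"] by blast
  obtain Q where Q: "finite Q" "card Q = q" "\<And>i. i \<in> {1..m} \<Longrightarrow> Q \<subseteq> e i"
    "\<And>i. i \<in> {1..m} \<Longrightarrow> card (e i - Q) = r - q"
    "\<And>i j. i \<in> {1..m} \<Longrightarrow> j \<in> {1..m} \<Longrightarrow> i \<noteq> j \<Longrightarrow> (e i - Q) \<inter> (e j - Q) = {}"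
    using delta_system_petals[OF e(1) assms(2)] by blast
  let ?U = "\<Union>i\<in>{1..m}. e i - Q"
  have fin: "finite (e i - Q)" if "i \<in> {1..m}" for i
    using e(2)[OF that] by (meson finite_Diff finite_lessThan finite_subset)
  have "card ?U = (\<Sum>i\<in>{1..m}. card (e i - Q))"
    using fin Q(5) by (intro card_UN_disjoint) auto
  then have "card ?U = (r - q) * m" using Q(4) by simp
  moreover have "card (?U \<union> Q) = card ?U + card Q"
    using fin Q(1) by (intro card_Un_disjoint) auto
  moreover have "?U \<union> Q \<subseteq> {..<?d}"
  proof -
    have "Q \<subseteq> {..<?d}" using Q(3)[of 1] e(2)[of 1] assms(2) by auto
    then show ?thesis using e(2) by blast
  qed
  then have "card (?U \<union> Q) \<le> ?d" using card_mono[of "{..<?d}" "?U \<union> Q"] by simp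
  ultimately show ?thesis using Q(2) by simp
qed

text \<open>The extremal colouring sums vertex weights: \<open>(r - q) * m - 1\<close> vertices have weight 0, the
  others carry a zero-sum free sequence. The core contributes an \<open>m\<close>-fold multiple, hence nothing,
  and the petals are too large to avoid the weighted vertices.\<close>

lemma delta_ramsey_lower_davenport:
  assumes "q < r" "0 < m" "group_exponent TYPE('g :: {ab_group_add, finite}) dvd m"
    and "1 < davenport TYPE('g)"
  shows "(r - q) * m + (davenport TYPE('g) - 1) \<le> delta_ramsey r q m TYPE('g)"
proof (rule ccontr)
  let ?d = "delta_ramsey r q m TYPE('g)" and ?D = "davenport TYPE('g)"
  assume "\<not> (r - q) * m + (?D - 1) \<le> ?d"
  \<comment> \<open>One less than the number of petal vertices, so the petals must meet a weighted
    vertex.\<close>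
  define z where "z = (r - q) * m - 1"
  have z: "z + 1 = (r - q) * m" using assms(1,2) by (simp add: z_def)
  have small: "?d \<le> z + (?D - 1)" using \<open>\<not> (r - q) * m + (?D - 1) \<le> ?d\<close> z by linarith
  have "?D - 1 < ?D" using assms(4) by simp
  then have "\<not> (0 < ?D - 1 \<and>
      (\<forall>s :: nat \<Rightarrow> 'g. \<exists>I \<subseteq> {..<?D - 1}. I \<noteq> {} \<and> (\<Sum>i\<in>I. s i) = 0))"
    unfolding davenport_def by (rule not_less_Least)
  \<comment> \<open>Since \<open>?D - 1\<close> is positive, its failure in the definition of
    \<open>davenport\<close> can only be a zero-sum free sequence of that length.\<close>
  then obtain s :: "nat \<Rightarrow> 'g" where
    s: "\<And>I. I \<subseteq> {..<?D - 1} \<Longrightarrow> I \<noteq> {} \<Longrightarrow> (\<Sum>i\<in>I. s i) \<noteq> 0"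
    using assms(4) by auto
  define w where "w v = (if v < z then 0 else s (v - z))" for v
  obtain e where e: "delta_system r q m e" "\<And>i. i \<in> {1..m} \<Longrightarrow> e i \<subseteq> {..<?d}"
    "(\<Sum>i=1..m. sum w (e i)) = 0"
    using delta_ramsey_property[OF assms(1,3), of "sum w"] by blast
  obtain Q where Q: "finite Q" "card Q = q" "\<And>i. i \<in> {1..m} \<Longrightarrow> Q \<subseteq> e i"
    "\<And>i. i \<in> {1..m} \<Longrightarrow> card (e i - Q) = r - q"
    "\<And>i j. i \<in> {1..m} \<Longrightarrow> j \<in> {1..m} \<Longrightarrow> i \<noteq> j \<Longrightarrow> (e i - Q) \<inter> (e j - Q) = {}"
    using delta_system_petals[OF e(1) assms(2)] by blast
  define U where "U = (\<Union>i\<in>{1..m}. e i - Q)"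
  have fin: "finite (e i)" if "i \<in> {1..m}" for i
    using e(2)[OF that] by (meson finite_lessThan finite_subset)
  have finU: "finite U" using fin by (auto simp: U_def)
  have "card U = (\<Sum>i\<in>{1..m}. card (e i - Q))"
    unfolding U_def using fin Q(5) by (intro card_UN_disjoint) auto
  then have cardU: "card U = (r - q) * m" using Q(4) by simp
  have "sum w U = (\<Sum>i\<in>{1..m}. sum w (e i - Q))"
    unfolding U_def using fin Q(5) by (intro sum.UNION_disjoint) auto
  also have "\<dots> = (\<Sum>i\<in>{1..m}. sum w (e i) - sum w Q)"
    using fin Q(3) by (intro sum.cong) (auto simp: sum_diff)
  also have "\<dots> = - (\<Sum>i\<in>{1..m}. sum w Q)" using e(3) by (simp add: sum_subtractf)
  also have "\<dots> = 0"
    using sum_constant_multiple[of "{1..m}" "sum w Q"] group_exponent_multiple(2)[OF assms(3)] by simp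
  finally have "sum w U = 0" .
  moreover have "sum w U = sum w {v \<in> U. z \<le> v}"
    by (rule sum.mono_neutral_right[OF finU]) (auto simp: w_def)
  moreover have "sum w {v \<in> U. z \<le> v} = sum s ((\<lambda>v. v - z) ` {v \<in> U. z \<le> v})"
  proof -
    have "inj_on (\<lambda>v. v - z) {v \<in> U. z \<le> v}" by (auto intro!: inj_onI)
    then show ?thesis by (simp add: sum.reindex w_def)
  qed
  moreover have "(\<lambda>v. v - z) ` {v \<in> U. z \<le> v} \<subseteq> {..<?D - 1}"
    using e(2) small by (fastforce simp: U_def)
  moreover have "{v \<in> U. z \<le> v} \<noteq> {}"
  proof
    assume "{v \<in> U. z \<le> v} = {}"
    then have "U \<subseteq> {..<z}" by force
    then have "card U \<le> z" using card_mono[of "{..<z}" U] by simp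
    then show False using cardU z by simp
  qed
  ultimately show False using s by (metis image_is_empty)
qed

theorem theorem1p2:
  fixes r q m :: nat
  assumes "q < r"
    and "card (UNIV :: 'g :: {ab_group_add, finite} set) \<le> m"
    and "group_exponent TYPE('g) dvd m"
  shows "(r - q) * m + max q (davenport TYPE('g) - 1) \<le> delta_ramsey r q m TYPE('g)
    \<and> delta_ramsey r q m TYPE('g)
        \<le> (r - q) * m + min ((r - q) * (davenport TYPE('g) - 1)) (card (UNIV :: 'g set) - 1) + q"
proof
  have "0 < m" using assms(2) finite_UNIV_card_ge_0[where ?'a = 'g] by simp
  note core = delta_ramsey_lower_core[OF assms(1) this assms(3)]
  show "(r - q) * m + max q (davenport TYPE('g) - 1) \<le> delta_ramsey r q m TYPE('g)"
  \<comment> \<open>Otherwise the maximum is \<open>q\<close>, and counting vertices is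
    enough.\<close>
  proof (cases "1 < davenport TYPE('g)")
    case True
    then show ?thesis
      using core delta_ramsey_lower_davenport[OF assms(1) \<open>0 < m\<close> assms(3)] by simp
  next
    case False
    then show ?thesis using core by simp
  qed
  show "delta_ramsey r q m TYPE('g)
      \<le> (r - q) * m + min ((r - q) * (davenport TYPE('g) - 1)) (card (UNIV :: 'g set) - 1) + q"
    using delta_ramsey_upper_davenport[OF assms] delta_ramsey_upper_card[OF assms]
    by (simp add: min_def)
qed

end
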